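(* Let $\mathfrak g$ be a basic Lie superalgebra over $\mathbb C$, $e\in\mathfrak g_{\bar0}$ nilpotent, and $d_1=\dim\mathfrak g_{\bar1}-\dim\mathfrak g^e_{\bar1}$. If $d_1$ is odd, then the finite $W$-superalgebra $U(\mathfrak g,e)$ over $\mathbb C$ cannot afford a one-dimensional representation.
   Context: Conventions. All vector spaces, algebras and modules (representations) are $\mathbb Z_2$-graded; $\dim V=\dim V_{\bar0}+\dim V_{\bar1}$. Basic Lie superalgebras over $\mathbb C$: $\mathfrak{gl}(m|n)$, $\mathfrak{sl}(m|n)$ with $m\neq n$, $\mathfrak{osp}(m|n)$ (even part $\mathfrak{so}(m)\oplus\mathfrak{sp}(n)$), $D(2,1;a)$ with $a$ algebraic, $F(4)$, $G(3)$. Each has an even non-degenerate supersymmetric invariant bilinear form $(\cdot,\cdot)$. Finite $W$-superalgebra. Fix an $\mathfrak{sl}_2$-triple $(e,h,f)$ in $\mathfrak g_{\bar0}$, normalise the form by $(e,f)=1$, put $\chi=(e,\cdot)\in\mathfrak g^*$, $\mathfrak g(i)=\{x:[h,x]=ix\}$, $\mathfrak g^e=\ker\operatorname{ad}e$. On $\mathfrak g(-1)_{\bar0}$ (resp. $\mathfrak g(-1)_{\bar1}$) the form $\langle x,y\rangle=\chi([x,y])$ is symplectic (resp. symmetric) non-degenerate; choose bases $u_1,\dots,u_{2s}$ with $\langle u_i,u_j\rangle=i^*\delta_{i+j,2s+1}$ ($i^*=-1$ for $i\le s$, $i^*=1$ for $i>s$), and $v_1,\dots,v_r$ with $\langle v_i,v_j\rangle=\delta_{i+j,r+1}$.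 The integers $r=\dim\mathfrak g(-1)_{\bar1}$ and $d_1$ have the same parity. Let $\mathfrak m=\bigoplus_{i\le-2}\mathfrak g(i)\oplus\operatorname{span}\{u_{s+1},\dots,u_{2s}\}\oplus\operatorname{span}\{v_j:j>\frac{r+1}{2}\}$. $\chi$ restricts to a character of $\mathfrak m$; $Q_\chi=U(\mathfrak g)\otimes_{U(\mathfrak m)}\mathbb C_\chi$ and $U(\mathfrak g,e)=(\operatorname{End}_{\mathfrak g}Q_\chi)^{\mathrm{op}}$. *)

theory Defs
  imports
    "HOL-Library.Z2"
    "HOL-Library.Function_Algebras"
    "HOL-Library.Poly_Mapping"
    "HOL-Computational_Algebra.Polynomial"
    "HOL-Algebra.QuotRing"
    "HOL-Algebra.Module"
    "HOL-Algebra.Generated_Groups"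
    "HOL-Algebra.Free_Abelian_Groups"
begin

section \<open>Lie superalgebras\<close>

text \<open>Parities are elements of the two-element field \<^typ>\<open>bit\<close>.  A Lie superalgebra is carried by
  the subspace \<open>part g 0 + part g 1\<close> of an ambient complex vector space, whose addition is that
  of the type class and whose scalar multiplication is \<open>smul g\<close>.\<close>

record 'a lie_super =
  smul :: "complex \<Rightarrow> 'a \<Rightarrow> 'a"
  part :: "bit \<Rightarrow> 'a set"
  br :: "'a \<Rightarrow> 'a \<Rightarrow> 'a"

definition lspace :: "('a :: ab_group_add) lie_super \<Rightarrow> 'a set" where
  "lspace g = {x + y | x y. x \<in> part g 0 \<and> y \<in> part g 1}"

text \<open>The Koszul sign \<open>(-1)^(ij)\<close>.\<close>

definition ksign :: "bit \<Rightarrow> bit \<Rightarrow> complex" where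
  "ksign i j = (if i = 1 \<and> j = 1 then - 1 else 1)"

locale lie_superalgebra =
  fixes g :: "('a :: ab_group_add) lie_super"
  assumes vs: "vector_space (smul g)"
    and part_subspace: "module.subspace (smul g) (part g i)"
    and part_disjoint: "part g 0 \<inter> part g 1 = {0}"
    and br_add_left: "\<lbrakk>x \<in> lspace g; y \<in> lspace g; z \<in> lspace g\<rbrakk>
          \<Longrightarrow> br g (x + y) z = br g x z + br g y z"
    and br_add_right: "\<lbrakk>x \<in> lspace g; y \<in> lspace g; z \<in> lspace g\<rbrakk>
          \<Longrightarrow> br g x (y + z) = br g x y + br g x z"
    and br_smul_left: "\<lbrakk>x \<in> lspace g; y \<in> lspace g\<rbrakk> \<Longrightarrow> br g (smul g c x) y = smul g c (br g x y)"
    and br_smul_right: "\<lbrakk>x \<in> lspace g; y \<in> lspace g\<rbrakk> \<Longrightarrow> br g x (smul g c y) = smul g c (br g x y)"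
    and br_part: "\<lbrakk>x \<in> part g i; y \<in> part g j\<rbrakk> \<Longrightarrow> br g x y \<in> part g (i + j)"
    and br_skew: "\<lbrakk>x \<in> part g i; y \<in> part g j\<rbrakk>
          \<Longrightarrow> br g x y = - smul g (ksign i j) (br g y x)"
    and jacobi: "\<lbrakk>x \<in> part g i; y \<in> part g j; z \<in> part g k\<rbrakk>
          \<Longrightarrow> br g x (br g y z) = br g (br g x y) z + smul g (ksign i j) (br g y (br g x z))"

definition restr :: "'a lie_super \<Rightarrow> 'a set \<Rightarrow> 'a lie_super" where
  "restr g M = g\<lparr>part := \<lambda>i. part g i \<inter> M\<rparr>"

definition lie_super_iso :: "('a :: ab_group_add) lie_super \<Rightarrow> ('b :: ab_group_add) lie_super \<Rightarrow> bool" where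
  "lie_super_iso g g' \<longleftrightarrow> (\<exists>\<phi>.
     bij_betw \<phi> (lspace g) (lspace g') \<and>
     (\<forall>x\<in>lspace g. \<forall>y\<in>lspace g. \<phi> (x + y) = \<phi> x + \<phi> y) \<and>
     (\<forall>c. \<forall>x\<in>lspace g. \<phi> (smul g c x) = smul g' c (\<phi> x)) \<and>
     (\<forall>i. \<phi> ` part g i = part g' i) \<and>
     (\<forall>x\<in>lspace g. \<forall>y\<in>lspace g. \<phi> (br g x y) = br g' (\<phi> x) (\<phi> y)))"

definition graded_subspace :: "('a :: ab_group_add) lie_super \<Rightarrow> 'a set \<Rightarrow> bool" where
  "graded_subspace g S \<longleftrightarrow> module.subspace (smul g) S \<and>
     S = {x + y | x y. x \<in> S \<inter> part g 0 \<and> y \<in> S \<inter> part g 1}"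


section \<open>The basic Lie superalgebras\<close>

text \<open>Matrices of size \<open>m + n\<close> are functions of two indices vanishing outside \<open>{..<m + n}\<close>;
  the indices below \<open>m\<close> are even, the remaining ones odd.\<close>

definition idx :: "nat \<Rightarrow> nat \<Rightarrow> bit" where
  "idx m i = (if i < m then 0 else 1)"

definition gl_part :: "nat \<Rightarrow> nat \<Rightarrow> bit \<Rightarrow> (nat \<Rightarrow> nat \<Rightarrow> complex) set" where
  "gl_part m n p = {A. \<forall>i j. A i j \<noteq> 0 \<longrightarrow> i < m + n \<and> j < m + n \<and> idx m i + idx m j = p}"

text \<open>The entry \<open>(i, k)\<close> of \<open>B\<close> belongs to its component of parity \<open>idx m i + idx m k\<close>, so the
  sign below is that of the supercommutator \<open>AB - (-1)^(|A||B|) BA\<close>, extended bilinearly.\<close>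

definition gl :: "nat \<Rightarrow> nat \<Rightarrow> (nat \<Rightarrow> nat \<Rightarrow> complex) lie_super" where
  "gl m n = \<lparr>smul = (\<lambda>c A i j. c * A i j), part = gl_part m n,
     br = (\<lambda>A B i j. \<Sum>k<m + n. A i k * B k j
            - ksign (idx m i + idx m k) (idx m k + idx m j) * (B i k * A k j))\<rparr>"

definition supertrace :: "nat \<Rightarrow> nat \<Rightarrow> (nat \<Rightarrow> nat \<Rightarrow> complex) \<Rightarrow> complex" where
  "supertrace m n A = (\<Sum>i<m. A i i) - (\<Sum>i=m..<m + n. A i i)"

definition sl :: "nat \<Rightarrow> nat \<Rightarrow> (nat \<Rightarrow> nat \<Rightarrow> complex) lie_super" where
  "sl m n = restr (gl m n) {A. supertrace m n A = 0}"

text \<open>Gram matrix (for even \<open>n\<close>) of the standard even supersymmetric form on \<open>\<complex>\<^bsup>m|n\<^esup>\<close>: symmetric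
  on the even part, symplectic on the odd part.\<close>

definition osp_form :: "nat \<Rightarrow> nat \<Rightarrow> nat \<Rightarrow> nat \<Rightarrow> complex" where
  "osp_form m n i j =
     (if i < m \<and> j = i then 1
      else if m \<le> i \<and> i < m + n div 2 \<and> j = i + n div 2 then 1
      else if m \<le> j \<and> j < m + n div 2 \<and> i = j + n div 2 then - 1
      else 0)"

text \<open>The homogeneous elements \<open>A\<close> with \<open>(Ax, y) + (-1)^(|A||x|) (x, Ay) = 0\<close>, evaluated on basis
  vectors \<open>x\<close>, \<open>y\<close>.\<close>

definition osp :: "nat \<Rightarrow> nat \<Rightarrow> (nat \<Rightarrow> nat \<Rightarrow> complex) lie_super" where
  "osp m n = (gl m n)\<lparr>part := \<lambda>p. {A \<in> gl_part m n p. \<forall>i<m + n. \<forall>j<m + n.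
      (\<Sum>k<m + n. A k i * osp_form m n k j)
      + ksign p (idx m i) * (\<Sum>k<m + n. osp_form m n i k * A k j) = 0}\<rparr>"

text \<open>\<open>contragredient g A N T\<close>: \<open>g\<close> is the contragredient Lie superalgebra (in the sense of Kac) with
  Cartan matrix \<open>A\<close> of size \<open>N\<close> and odd simple roots indexed by \<open>T\<close>.  That is, \<open>g\<close> is generated
  by elements satisfying the defining relations, with the \<open>h\<^sub>i\<close> linearly independent, and has no
  nonzero graded ideal meeting the span of the \<open>h\<^sub>i\<close> trivially.  The Cartan matrices to which this
  is applied below are invertible, so the Cartan subalgebra is spanned by the \<open>h\<^sub>i\<close>.\<close>

definition contragredient ::
  "('a :: ab_group_add) lie_super \<Rightarrow> (nat \<Rightarrow> nat \<Rightarrow> complex) \<Rightarrow> nat \<Rightarrow> nat set \<Rightarrow> bool" where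
  "contragredient g A N T \<longleftrightarrow> (\<exists>E F H.
     (\<forall>i<N. H i \<in> part g 0 \<and>
        E i \<in> part g (if i \<in> T then 1 else 0) \<and> F i \<in> part g (if i \<in> T then 1 else 0)) \<and>
     (\<forall>i<N. \<forall>j<N.
        br g (E i) (F j) = (if i = j then H i else 0) \<and> br g (H i) (H j) = 0 \<and>
        br g (H i) (E j) = smul g (A i j) (E j) \<and> br g (H i) (F j) = - smul g (A i j) (F j)) \<and>
     inj_on H {..<N} \<and> \<not> module.dependent (smul g) (H ` {..<N}) \<and>
     (\<forall>S. graded_subspace g S \<and> (\<forall>x\<in>S. \<forall>y\<in>S. br g x y \<in> S)
          \<and> (E ` {..<N} \<union> F ` {..<N} \<union> H ` {..<N}) \<subseteq> S \<longrightarrow> lspace g \<subseteq> S) \<and>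
     (\<forall>J. graded_subspace g J \<and> (\<forall>x\<in>lspace g. \<forall>y\<in>J. br g x y \<in> J)
          \<and> J \<inter> module.span (smul g) (H ` {..<N}) = {0} \<longrightarrow> J = {0}))"

definition mat_of :: "complex list list \<Rightarrow> nat \<Rightarrow> nat \<Rightarrow> complex" where
  "mat_of rows i j = rows ! i ! j"

text \<open>The distinguished Cartan matrices of Kac's table; the first simple root is the odd one.\<close>

definition is_D21 :: "complex \<Rightarrow> ('a :: ab_group_add) lie_super \<Rightarrow> bool" where
  "is_D21 a g \<longleftrightarrow> contragredient g (mat_of [[0, 1, a], [-1, 2, 0], [-1, 0, 2]]) 3 {0}"

definition is_F4 :: "('a :: ab_group_add) lie_super \<Rightarrow> bool" where
  "is_F4 g \<longleftrightarrow>
     contragredient g (mat_of [[0, 1, 0, 0], [-1, 2, -2, 0], [0, -1, 2, -1], [0, 0, -1, 2]]) 4 {0}"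

definition is_G3 :: "('a :: ab_group_add) lie_super \<Rightarrow> bool" where
  "is_G3 g \<longleftrightarrow> contragredient g (mat_of [[0, 1, 0], [-1, 2, -3], [0, -1, 2]]) 3 {0}"

definition finite_dimensional :: "('a :: ab_group_add) lie_super \<Rightarrow> bool" where
  "finite_dimensional g \<longleftrightarrow> (\<exists>X. finite X \<and> lspace g \<subseteq> module.span (smul g) X)"

text \<open>All algebras listed are finite-dimensional Lie superalgebras (of dimensions \<open>9|8\<close>, \<open>24|16\<close> and
  \<open>17|14\<close> in the contragredient cases); the first two conjuncts record this and exclude none of
  them.\<close>

definition basic_lie_superalgebra :: "('a :: ab_group_add) lie_super \<Rightarrow> bool" where
  "basic_lie_superalgebra g \<longleftrightarrow> lie_superalgebra g \<and> finite_dimensional g \<and>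
     ((\<exists>m n. lie_super_iso g (gl m n)) \<or>
      (\<exists>m n. m \<noteq> n \<and> lie_super_iso g (sl m n)) \<or>
      (\<exists>m n. even n \<and> lie_super_iso g (osp m n)) \<or>
      (\<exists>a. algebraic a \<and> a \<noteq> 0 \<and> a \<noteq> - 1 \<and> is_D21 a g) \<or>
      is_F4 g \<or> is_G3 g)"


section \<open>Nilpotent elements, forms and the subalgebra \<open>m\<close>\<close>

text \<open>Nilpotency in the reductive Lie algebra \<open>part g 0\<close>: the first conjunct excludes central
  elements such as the identity matrix.\<close>

definition nilpotent_element :: "('a :: ab_group_add) lie_super \<Rightarrow> 'a \<Rightarrow> bool" where
  "nilpotent_element g e \<longleftrightarrow> e \<in> part g 0 \<and>
     e \<in> module.span (smul g) {br g x y | x y. x \<in> part g 0 \<and> y \<in> part g 0} \<and>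
     (\<exists>k. \<forall>x\<in>lspace g. (br g e ^^ k) x = 0)"

definition sl2_triple :: "('a :: ab_group_add) lie_super \<Rightarrow> 'a \<Rightarrow> 'a \<Rightarrow> 'a \<Rightarrow> bool" where
  "sl2_triple g e h f \<longleftrightarrow> e \<in> part g 0 \<and> h \<in> part g 0 \<and> f \<in> part g 0 \<and>
     br g h e = smul g 2 e \<and> br g h f = smul g (- 2) f \<and> br g e f = h"

text \<open>Even, non-degenerate, supersymmetric, invariant bilinear forms.\<close>

definition invariant_form :: "('a :: ab_group_add) lie_super \<Rightarrow> ('a \<Rightarrow> 'a \<Rightarrow> complex) \<Rightarrow> bool" where
  "invariant_form g B \<longleftrightarrow>
     (\<forall>x\<in>lspace g. \<forall>y\<in>lspace g. \<forall>z\<in>lspace g.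
        B (x + y) z = B x z + B y z \<and> B z (x + y) = B z x + B z y) \<and>
     (\<forall>c. \<forall>x\<in>lspace g. \<forall>y\<in>lspace g. B (smul g c x) y = c * B x y \<and> B x (smul g c y) = c * B x y) \<and>
     (\<forall>x\<in>part g 0. \<forall>y\<in>part g 1. B x y = 0 \<and> B y x = 0) \<and>
     (\<forall>x\<in>lspace g. (\<forall>y\<in>lspace g. B x y = 0) \<longrightarrow> x = 0) \<and>
     (\<forall>i j. \<forall>x\<in>part g i. \<forall>y\<in>part g j. B x y = ksign i j * B y x) \<and>
     (\<forall>x\<in>lspace g. \<forall>y\<in>lspace g. \<forall>z\<in>lspace g. B (br g x y) z = B x (br g y z))"

text \<open>The normalisation \<open>(e, f) = 1\<close> is a rescaling of the form, hence is imposed only if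
  \<open>(e, f) \<noteq> 0\<close>.  The value \<open>(e, f)\<close> is zero for \<open>e = 0\<close>, but also for some nonzero nilpotent \<open>e\<close>
  and every invariant form, for instance in \<open>gl(2|2)\<close> with \<open>e\<close> regular.\<close>

definition normalised_form ::
  "('a :: ab_group_add) lie_super \<Rightarrow> 'a \<Rightarrow> 'a \<Rightarrow> ('a \<Rightarrow> 'a \<Rightarrow> complex) \<Rightarrow> bool" where
  "normalised_form g e f B \<longleftrightarrow> invariant_form g B \<and> (B e f \<noteq> 0 \<longrightarrow> B e f = 1)"

definition eigenspace :: "('a :: ab_group_add) lie_super \<Rightarrow> 'a \<Rightarrow> int \<Rightarrow> 'a set" where
  "eigenspace g h k = {x \<in> lspace g. br g h x = smul g (of_int k) x}"

definition indexed_basis ::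
  "(complex \<Rightarrow> 'a \<Rightarrow> 'a) \<Rightarrow> (nat \<Rightarrow> 'a :: ab_group_add) \<Rightarrow> nat \<Rightarrow> 'a set \<Rightarrow> bool" where
  "indexed_basis sc b n S \<longleftrightarrow> inj_on b {1..n} \<and> \<not> module.dependent sc (b ` {1..n}) \<and>
     module.span sc (b ` {1..n}) = S"

definition adapted_bases ::
  "('a :: ab_group_add) lie_super \<Rightarrow> 'a \<Rightarrow> ('a \<Rightarrow> complex) \<Rightarrow> nat \<Rightarrow> (nat \<Rightarrow> 'a) \<Rightarrow> nat \<Rightarrow> (nat \<Rightarrow> 'a) \<Rightarrow> bool"
  where
  "adapted_bases g h \<chi> s u r v \<longleftrightarrow>
     indexed_basis (smul g) u (2 * s) (eigenspace g h (- 1) \<inter> part g 0) \<and>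
     indexed_basis (smul g) v r (eigenspace g h (- 1) \<inter> part g 1) \<and>
     (\<forall>i\<in>{1..2 * s}. \<forall>j\<in>{1..2 * s}. \<chi> (br g (u i) (u j)) =
        (if i + j = 2 * s + 1 then (if i \<le> s then - 1 else 1) else 0)) \<and>
     (\<forall>i\<in>{1..r}. \<forall>j\<in>{1..r}. \<chi> (br g (v i) (v j)) = (if i + j = r + 1 then 1 else 0))"

definition m_space ::
  "('a :: ab_group_add) lie_super \<Rightarrow> 'a \<Rightarrow> nat \<Rightarrow> (nat \<Rightarrow> 'a) \<Rightarrow> nat \<Rightarrow> (nat \<Rightarrow> 'a) \<Rightarrow> 'a set" where
  "m_space g h s u r v = module.span (smul g)
     ((\<Union>k\<in>{..- 2}. eigenspace g h k) \<union> u ` {s + 1..2 * s} \<union> v ` {j. j \<le> r \<and> r + 1 < 2 * j})"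

definition centralizer :: "('a :: ab_group_add) lie_super \<Rightarrow> 'a \<Rightarrow> 'a set" where
  "centralizer g e = {x \<in> lspace g. br g e x = 0}"

definition d1 :: "('a :: ab_group_add) lie_super \<Rightarrow> 'a \<Rightarrow> int" where
  "d1 g e = int (vector_space.dim (smul g) (part g 1))
          - int (vector_space.dim (smul g) (centralizer g e \<inter> part g 1))"


section \<open>Universal enveloping superalgebras\<close>

instantiation list :: (type) monoid_add
begin

definition zero_list :: "'a list" where "zero_list = []"
definition plus_list :: "'a list \<Rightarrow> 'a list \<Rightarrow> 'a list" where "plus_list = (@)"

instance by standard (simp_all add: zero_list_def plus_list_def)

end

text \<open>With words added by concatenation, the multiplication of \<^typ>\<open>'a list \<Rightarrow>\<^sub>0 complex\<close> is that of the
  free associative algebra on the letters \<^typ>\<open>'a\<close>.\<close>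

definition free_alg :: "'a set \<Rightarrow> ('a list \<Rightarrow>\<^sub>0 complex) ring" where
  "free_alg L = \<lparr>carrier = {p. Poly_Mapping.keys p \<subseteq> lists L}, mult = (*), one = 1, ring.zero = 0, add = (+)\<rparr>"

definition letter :: "'a \<Rightarrow> 'a list \<Rightarrow>\<^sub>0 complex" where
  "letter x = Poly_Mapping.single [x] 1"

definition const :: "complex \<Rightarrow> 'a list \<Rightarrow>\<^sub>0 complex" where
  "const c = Poly_Mapping.single [] c"

definition uea_rels :: "('a :: ab_group_add) lie_super \<Rightarrow> ('a list \<Rightarrow>\<^sub>0 complex) set" where
  "uea_rels g =
     {letter (x + y) - letter x - letter y | x y. x \<in> lspace g \<and> y \<in> lspace g} \<union>
     {letter (smul g c x) - const c * letter x | c x. x \<in> lspace g} \<union>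
     {letter x * letter y - const (ksign i j) * letter y * letter x - letter (br g x y) | x y i j.
        x \<in> part g i \<and> y \<in> part g j}"

definition uea_ideal :: "('a :: ab_group_add) lie_super \<Rightarrow> ('a list \<Rightarrow>\<^sub>0 complex) set" where
  "uea_ideal g = genideal (free_alg (lspace g)) (uea_rels g)"

definition UEA :: "('a :: ab_group_add) lie_super \<Rightarrow> ('a list \<Rightarrow>\<^sub>0 complex) set ring" where
  "UEA g = free_alg (lspace g) Quot uea_ideal g"

definition uea_class :: "('a :: ab_group_add) lie_super \<Rightarrow> ('a list \<Rightarrow>\<^sub>0 complex) \<Rightarrow> ('a list \<Rightarrow>\<^sub>0 complex) set" where
  "uea_class g p = uea_ideal g +>\<^bsub>free_alg (lspace g)\<^esub> p"

text \<open>Words whose letters are homogeneous of total parity \<open>i\<close>; their linear combinations represent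
  the component of parity \<open>i\<close>.\<close>

definition parity_words :: "('a :: ab_group_add) lie_super \<Rightarrow> bit \<Rightarrow> 'a list set" where
  "parity_words g i = {w. \<exists>ps. list_all2 (\<lambda>x p. x \<in> part g p) w ps \<and> sum_list ps = i}"

definition uea_part :: "('a :: ab_group_add) lie_super \<Rightarrow> bit \<Rightarrow> ('a list \<Rightarrow>\<^sub>0 complex) set set" where
  "uea_part g i = uea_class g ` {p. Poly_Mapping.keys p \<subseteq> parity_words g i}"

text \<open>The homomorphism \<open>U(k) \<rightarrow> U(g)\<close> induced by an inclusion \<open>k \<subseteq> g\<close>; a coset of the smaller
  ideal lies in a single coset of the larger one.\<close>

definition uea_incl :: "('a :: ab_group_add) lie_super \<Rightarrow> ('a list \<Rightarrow>\<^sub>0 complex) set \<Rightarrow> ('a list \<Rightarrow>\<^sub>0 complex) set" where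
  "uea_incl g y = the_elem (uea_class g ` y)"

text \<open>The scalar by which an element of the enveloping algebra acts on the one-dimensional module
  given by a character \<open>\<chi>\<close>.\<close>

definition uea_char :: "('a \<Rightarrow> complex) \<Rightarrow> ('a list \<Rightarrow>\<^sub>0 complex) set \<Rightarrow> complex" where
  "uea_char \<chi> y = the_elem
     ((\<lambda>p. \<Sum>w\<in>Poly_Mapping.keys p. Poly_Mapping.lookup p w * prod_list (map \<chi> w)) ` y)"


section \<open>Tensor products and the module \<open>Q\<^sub>\<chi>\<close>\<close>

text \<open>The tensor product of a right module \<open>M\<close> and a left module \<open>N\<close> over a ring with carrier \<open>R\<close>,
  as a quotient of the free abelian group on \<open>M \<times> N\<close>.  The quotient is a \<^typ>\<open>'a monoid\<close>, so its
  addition is written \<open>mult\<close>.\<close>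

definition tensor_rels ::
  "'r set \<Rightarrow> ('m, 'x) ring_scheme \<Rightarrow> ('n, 'y) ring_scheme \<Rightarrow> ('m \<Rightarrow> 'r \<Rightarrow> 'm) \<Rightarrow> ('r \<Rightarrow> 'n \<Rightarrow> 'n)
   \<Rightarrow> (('m \<times> 'n) \<Rightarrow>\<^sub>0 int) set" where
  "tensor_rels R M N ra la = generate (free_Abelian_group (carrier M \<times> carrier N))
     ({frag_of (m \<oplus>\<^bsub>M\<^esub> m', n) - frag_of (m, n) - frag_of (m', n) | m m' n.
         m \<in> carrier M \<and> m' \<in> carrier M \<and> n \<in> carrier N} \<union>
      {frag_of (m, n \<oplus>\<^bsub>N\<^esub> n') - frag_of (m, n) - frag_of (m, n') | m n n'.
         m \<in> carrier M \<and> n \<in> carrier N \<and> n' \<in> carrier N} \<union>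
      {frag_of (ra m y, n) - frag_of (m, la y n) | m y n.
         m \<in> carrier M \<and> y \<in> R \<and> n \<in> carrier N})"

definition tensor_product ::
  "'r set \<Rightarrow> ('m, 'x) ring_scheme \<Rightarrow> ('n, 'y) ring_scheme \<Rightarrow> ('m \<Rightarrow> 'r \<Rightarrow> 'm) \<Rightarrow> ('r \<Rightarrow> 'n \<Rightarrow> 'n)
   \<Rightarrow> (('m \<times> 'n) \<Rightarrow>\<^sub>0 int) set monoid" where
  "tensor_product R M N ra la =
     free_Abelian_group (carrier M \<times> carrier N) Mod tensor_rels R M N ra la"

definition complex_ring :: "complex ring" where
  "complex_ring = \<lparr>carrier = UNIV, mult = (*), one = 1, ring.zero = 0, add = (+)\<rparr>"

type_synonym 'a uea_elem = "('a list \<Rightarrow>\<^sub>0 complex) set"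
type_synonym 'a q_elem = "(('a uea_elem \<times> complex) \<Rightarrow>\<^sub>0 int) set"

text \<open>\<open>Q\<^sub>\<chi> = U(g) \<otimes>\<^bsub>U(m)\<^esub> \<complex>\<^sub>\<chi>\<close>, where \<open>m = restr g M\<close>.\<close>

definition Q_rels :: "('a :: ab_group_add) lie_super \<Rightarrow> ('a \<Rightarrow> complex) \<Rightarrow> 'a set
   \<Rightarrow> (('a uea_elem \<times> complex) \<Rightarrow>\<^sub>0 int) set" where
  "Q_rels g \<chi> M = tensor_rels (carrier (UEA (restr g M))) (UEA g) complex_ring
     (\<lambda>a y. a \<otimes>\<^bsub>UEA g\<^esub> uea_incl g y) (\<lambda>y c. uea_char \<chi> y * c)"

definition Q :: "('a :: ab_group_add) lie_super \<Rightarrow> ('a \<Rightarrow> complex) \<Rightarrow> 'a set \<Rightarrow> 'a q_elem monoid" where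
  "Q g \<chi> M = tensor_product (carrier (UEA (restr g M))) (UEA g) complex_ring
     (\<lambda>a y. a \<otimes>\<^bsub>UEA g\<^esub> uea_incl g y) (\<lambda>y c. uea_char \<chi> y * c)"

definition Q_class :: "('a :: ab_group_add) lie_super \<Rightarrow> ('a \<Rightarrow> complex) \<Rightarrow> 'a set
   \<Rightarrow> (('a uea_elem \<times> complex) \<Rightarrow>\<^sub>0 int) \<Rightarrow> 'a q_elem" where
  "Q_class g \<chi> M t = Q_rels g \<chi> M #>\<^bsub>free_Abelian_group (carrier (UEA g) \<times> UNIV)\<^esub> t"

text \<open>The left action of \<open>a \<in> U(g)\<close>, induced by \<open>b \<otimes> c \<mapsto> ab \<otimes> c\<close>.\<close>

definition Q_act :: "('a :: ab_group_add) lie_super \<Rightarrow> ('a \<Rightarrow> complex) \<Rightarrow> 'a set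
   \<Rightarrow> 'a uea_elem \<Rightarrow> 'a q_elem \<Rightarrow> 'a q_elem" where
  "Q_act g \<chi> M a q = the_elem
     ((\<lambda>t. Q_class g \<chi> M (frag_extend (\<lambda>(b, c). frag_of (a \<otimes>\<^bsub>UEA g\<^esub> b, c)) t)) ` q)"

definition Q_smul :: "('a :: ab_group_add) lie_super \<Rightarrow> ('a \<Rightarrow> complex) \<Rightarrow> 'a set
   \<Rightarrow> complex \<Rightarrow> 'a q_elem \<Rightarrow> 'a q_elem" where
  "Q_smul g \<chi> M c = Q_act g \<chi> M (uea_class g (const c))"

text \<open>The vector \<open>1 \<in> \<complex>\<^sub>\<chi>\<close> is even.\<close>

definition Q_part :: "('a :: ab_group_add) lie_super \<Rightarrow> ('a \<Rightarrow> complex) \<Rightarrow> 'a set \<Rightarrow> bit \<Rightarrow> 'a q_elem set" where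
  "Q_part g \<chi> M i =
     generate (Q g \<chi> M) {Q_class g \<chi> M (frag_of (a, c)) | a c. a \<in> uea_part g i}"


section \<open>The finite W-superalgebra and its representations\<close>

record 'b superalgebra = "(complex, 'b) module" +
  homog :: "bit \<Rightarrow> 'b set"

text \<open>Elements of \<open>End\<^sub>g Q\<^sub>\<chi>\<close> are represented by extensional functions on the carrier.\<close>

definition End_Q :: "('a :: ab_group_add) lie_super \<Rightarrow> ('a \<Rightarrow> complex) \<Rightarrow> 'a set
   \<Rightarrow> ('a q_elem \<Rightarrow> 'a q_elem) set" where
  "End_Q g \<chi> M = {F \<in> extensional (carrier (Q g \<chi> M)). F \<in> hom (Q g \<chi> M) (Q g \<chi> M) \<and>
     (\<forall>c. \<forall>q\<in>carrier (Q g \<chi> M). F (Q_smul g \<chi> M c q) = Q_smul g \<chi> M c (F q)) \<and>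
     (\<forall>x\<in>lspace g. \<forall>q\<in>carrier (Q g \<chi> M).
        F (Q_act g \<chi> M (uea_class g (letter x)) q) = Q_act g \<chi> M (uea_class g (letter x)) (F q))}"

text \<open>\<open>U(g, e) = (End\<^sub>g Q\<^sub>\<chi>)\<^sup>o\<^sup>p\<close> for \<open>\<chi> = (e, \<cdot>)\<close>.  Endomorphisms commute with the left action without
  signs and the opposite product carries no sign either: writing endomorphisms on the right of their
  arguments, no sign rule intervenes, and \<open>F \<mapsto> F (1 \<otimes> 1)\<close> is multiplicative.\<close>

definition W_superalgebra :: "('a :: ab_group_add) lie_super \<Rightarrow> ('a \<Rightarrow> complex) \<Rightarrow> 'a set
   \<Rightarrow> ('a q_elem \<Rightarrow> 'a q_elem) superalgebra" where
  "W_superalgebra g \<chi> M =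
     \<lparr>carrier = End_Q g \<chi> M,
      mult = (\<lambda>F G. compose (carrier (Q g \<chi> M)) G F),
      one = (\<lambda>q\<in>carrier (Q g \<chi> M). q),
      ring.zero = (\<lambda>q\<in>carrier (Q g \<chi> M). \<one>\<^bsub>Q g \<chi> M\<^esub>),
      add = (\<lambda>F G. \<lambda>q\<in>carrier (Q g \<chi> M). F q \<otimes>\<^bsub>Q g \<chi> M\<^esub> G q),
      smult = (\<lambda>c F. \<lambda>q\<in>carrier (Q g \<chi> M). Q_smul g \<chi> M c (F q)),
      homog = (\<lambda>i. {F \<in> End_Q g \<chi> M. \<forall>j. F ` Q_part g \<chi> M j \<subseteq> Q_part g \<chi> M (i + j)})\<rparr>"

text \<open>A (\<open>\<int>\<^sub>2\<close>-graded) representation on the superspace \<open>V 0 \<oplus> V 1\<close>, which exhausts the type \<^typ>\<open>'v\<close>.\<close>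

definition super_representation ::
  "'b superalgebra \<Rightarrow> (complex \<Rightarrow> 'v \<Rightarrow> 'v) \<Rightarrow> (bit \<Rightarrow> ('v :: ab_group_add) set) \<Rightarrow> ('b \<Rightarrow> 'v \<Rightarrow> 'v) \<Rightarrow> bool"
  where
  "super_representation A sc V \<rho> \<longleftrightarrow>
     vector_space sc \<and> (\<forall>i. module.subspace sc (V i)) \<and> V 0 \<inter> V 1 = {0} \<and>
     {x + y | x y. x \<in> V 0 \<and> y \<in> V 1} = UNIV \<and>
     (\<forall>a\<in>carrier A. Vector_Spaces.linear sc sc (\<rho> a)) \<and>
     (\<forall>a\<in>carrier A. \<forall>b\<in>carrier A.
        \<rho> (a \<oplus>\<^bsub>A\<^esub> b) = (\<lambda>x. \<rho> a x + \<rho> b x) \<and> \<rho> (a \<otimes>\<^bsub>A\<^esub> b) = \<rho> a \<circ> \<rho> b) \<and>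
     (\<forall>c. \<forall>a\<in>carrier A. \<rho> (c \<odot>\<^bsub>A\<^esub> a) = (\<lambda>x. sc c (\<rho> a x))) \<and>
     \<rho> \<one>\<^bsub>A\<^esub> = id \<and>
     (\<forall>i j. \<forall>a\<in>homog A i. \<rho> a ` V j \<subseteq> V (i + j))"

end

theory Submission
  imports Defs
begin

text \<open>
  Write \<open>\<chi> = (e, \<cdot>)\<close> and suppose that \<open>d\<^sub>1\<close> is odd.  The algebra \<open>U(g, e)\<close> then contains an odd
  element whose square is the scalar \<open>1/2\<close>.  On a one-dimensional superspace one of the two
  parity components vanishes, so every odd element acts by zero, and \<open>1/2\<close> would have to act by
  zero as well.

  The odd element is right multiplication by the middle vector \<open>v\<close>, of index \<open>(r + 1)/2\<close>, of the
  given basis of \<open>g(-1)\<^sub>1\<close>; it exists once \<open>r\<close> is odd.  The shape of the Gram matrix gives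
  \<open>[m, v] \<subseteq> m\<close> and \<open>\<chi>([m, v]) = 0\<close>, so \<open>v\<close> applied to the generator of \<open>Q\<^sub>\<chi>\<close> is again a Whittaker
  vector, and \<open>a \<otimes> c \<mapsto> av \<otimes> c\<close> is a well-defined endomorphism of \<open>Q\<^sub>\<chi>\<close> (\<open>tens_right_mult\<close>).
  Its square is right multiplication by \<open>v\<^sup>2 = [v, v]/2\<close>, and \<open>[v, v] \<in> m\<close> acts on the generator by
  \<open>\<chi>([v, v]) = 1\<close> (\<open>\<Theta>_square\<close>).

  It remains to see that \<open>r\<close> is odd, that is \<open>d\<^sub>1 \<equiv> r\<close> modulo 2 (\<open>d1_parity\<close>).  The form
  \<open>\<omega>(x, y) = \<chi>([x, y])\<close> on \<open>g\<^sub>1\<close> is symmetric with radical \<open>g\<^sup>e\<^sub>1\<close>.  Since \<open>\<chi>\<close> lives on the weight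
  space \<open>g(-2)\<close>, the operator \<open>A = ad h + 1\<close> is skew for \<open>\<omega>\<close>, so \<open>\<omega>(Ax, y)\<close> is alternating and
  has even rank.  Its radical consists of the \<open>x\<close> with \<open>Ax \<in> g\<^sup>e\<^sub>1\<close>.  As \<open>\<omega>\<close> is non-degenerate on
  \<open>ker A = g(-1)\<^sub>1\<close>, this kernel meets \<open>g\<^sup>e\<^sub>1\<close> trivially.  A skew operator preserves the radical of
  the form, so \<open>A\<close> maps \<open>g\<^sup>e\<^sub>1\<close> bijectively to itself and the radical of \<open>\<omega>(Ax, y)\<close> is \<open>g(-1)\<^sub>1 \<oplus> g\<^sup>e\<^sub>1\<close>.  Therefore \<open>dim g\<^sub>1 - dim g\<^sup>e\<^sub>1 - r\<close> is even.
\<close>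

section \<open>Alternating forms\<close>

context vector_space begin

lemma dim_direct_sum:
  assumes S: "subspace S" and T: "subspace T" and X: "finite X" "S \<subseteq> span X" "T \<subseteq> span X"
    and ST: "S \<inter> T \<subseteq> {0}"
  shows "dim {x + y | x y. x \<in> S \<and> y \<in> T} = dim S + dim T"
proof -
  obtain BS where BS: "BS \<subseteq> S" "independent BS" "S \<subseteq> span BS" "card BS = dim S"
    using basis_exists by blast
  obtain BT where BT: "BT \<subseteq> T" "independent BT" "T \<subseteq> span BT" "card BT = dim T"
    using basis_exists by blast
  have fin: "finite BS" "finite BT"
    using BS BT X independent_span_bound by (meson subset_trans)+
  have spS: "span BS = S" and spT: "span BT = T"
    using BS BT S T by (metis span_minimal subset_antisym)+
  have ind: "independent (BS \<union> C) \<and> BS \<inter> C = {}" if "C \<subseteq> BT" for C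
    using finite_subset[OF that fin(2)] that
  proof (induction C rule: finite_induct)
    case empty
    then show ?case using BS by simp
  next
    case (insert c C)
    have indc: "independent (insert c C)" using independent_mono BT insert by blast
    have "c \<notin> span (BS \<union> C)"
    proof
      assume "c \<in> span (BS \<union> C)"
      then obtain a b where ab: "c = a + b" "a \<in> span BS" "b \<in> span C"
        by (auto simp: span_Un)
      have "b \<in> T" using ab insert.prems spT span_mono by blast
      moreover have "c \<in> T" using insert.prems BT by blast
      ultimately have "a \<in> T" using ab T by (metis add_diff_cancel_right' subspace_diff)
      hence "a = 0" using ab spS ST by blast
      hence "c \<in> span C" using ab by simp
      thus False using indc insert.hyps(2) dependent_insertD[of c C]
        by (metis Diff_insert_absorb dependent_def insertI1)
    qed
    moreover from this have "c \<notin> BS" by (meson UnI1 span_base)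
    ultimately show ?case using insert independent_insertI by auto
  qed
  have "{x + y | x y. x \<in> S \<and> y \<in> T} = span (BS \<union> BT)"
    by (auto simp: span_Un spS spT)
  then show ?thesis
    using ind[OF subset_refl] fin BS(4) BT(4)
    by (metis card_Un_disjoint dim_span_eq_card_independent)
qed

text \<open>The usual dimension count, for a map that need only be linear on a finite-dimensional
  subspace of an ambient space that may be infinite-dimensional and on which the map is arbitrary
  elsewhere.\<close>

lemma injective_imp_surjective_on:
  assumes R: "subspace R" and X: "finite X" "R \<subseteq> span X"
    and A: "\<And>x. x \<in> R \<Longrightarrow> A x \<in> R"
    and add: "\<And>x y. \<lbrakk>x \<in> R; y \<in> R\<rbrakk> \<Longrightarrow> A (x + y) = A x + A y"
    and scl: "\<And>c x. x \<in> R \<Longrightarrow> A (c *s x) = c *s A x"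
    and inj: "\<And>x. \<lbrakk>x \<in> R; A x = 0\<rbrakk> \<Longrightarrow> x = 0"
  shows "A ` R = R"
proof -
  obtain C where C: "C \<subseteq> R" "independent C" "R \<subseteq> span C" "card C = dim R"
    using basis_exists by blast
  have fin: "finite C" using C X independent_span_bound by (meson subset_trans)
  have spC: "span C = R" using C R by (metis span_minimal subset_antisym)
  have A0: "A 0 = 0" using scl[of 0 0] R subspace_0 by simp
  have diff: "A (x - y) = A x - A y" if "x \<in> R" "y \<in> R" for x y
    using add[of "x - y" y] that R by (simp add: subspace_diff)
  have injA: "inj_on A R"
  proof (rule inj_onI)
    fix x y assume "x \<in> R" "y \<in> R" "A x = A y"
    then show "x = y" using inj[of "x - y"] diff[of x y] R by (simp add: subspace_diff)
  qed
  have sumA: "(\<Sum>b\<in>C. c b *s A b) = A (\<Sum>b\<in>C. c b *s b)" for c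
  proof -
    have "(\<Sum>b\<in>D. c b *s A b) = A (\<Sum>b\<in>D. c b *s b)" if "D \<subseteq> C" for D
      using finite_subset[OF that fin] that
    proof (induction D rule: finite_induct)
      case (insert b D)
      have "b \<in> R" "D \<subseteq> R" using insert C by auto
      then have "A (c b *s b + (\<Sum>b\<in>D. c b *s b)) = A (c b *s b) + A (\<Sum>b\<in>D. c b *s b)"
        by (intro add subspace_scale subspace_sum R) auto
      then show ?case using insert \<open>b \<in> R\<close> by (simp add: scl)
    qed (simp add: A0)
    then show ?thesis by blast
  qed
  have indA: "independent (A ` C)"
  proof (rule independent_if_scalars_zero)
    fix f x assume s: "(\<Sum>x\<in>A ` C. f x *s x) = 0" and x: "x \<in> A ` C"
    have "A (\<Sum>b\<in>C. f (A b) *s b) = 0"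
      using s sum.reindex[OF inj_on_subset[OF injA C(1)], of "\<lambda>x. f x *s x"]
      by (simp add: sumA[symmetric] o_def)
    moreover have "(\<Sum>b\<in>C. f (A b) *s b) \<in> R"
      using C(1) by (intro subspace_sum subspace_scale R) auto
    ultimately have "(\<Sum>b\<in>C. f (A b) *s b) = 0" using inj by blast
    moreover obtain b where "b \<in> C" "x = A b" using x by (elim imageE)
    ultimately show "f x = 0" using independentD[OF C(2) fin subset_refl, of "\<lambda>b. f (A b)" b] by simp
  qed (use fin in simp)
  have sub: "A ` C \<subseteq> span C" using C A spC by blast
  have cardA: "card (A ` C) = card C" by (rule card_image[OF inj_on_subset[OF injA C(1)]])
  have "C \<subseteq> span (A ` C)"
  proof
    fix c assume c: "c \<in> C"
    show "c \<in> span (A ` C)"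
    proof (rule ccontr)
      assume n: "c \<notin> span (A ` C)"
      have "independent (insert c (A ` C))" using n indA by (rule independent_insertI)
      moreover have "insert c (A ` C) \<subseteq> span C" using sub c span_base by auto
      ultimately have "card (insert c (A ` C)) \<le> card C"
        using independent_span_bound[OF fin] by simp
      moreover have "c \<notin> A ` C" using n span_base by auto
      ultimately show False using cardA fin by simp
    qed
  qed
  then have "R \<subseteq> span (A ` C)" using span_minimal[OF _ subspace_span] spC by metis
  moreover have "span (A ` C) \<subseteq> A ` R"
  proof (rule span_minimal)
    show "A ` C \<subseteq> A ` R" using C by blast
    show "subspace (A ` R)"
    proof (rule subspaceI)
      show "0 \<in> A ` R" using A0 subspace_0[OF R] by force
      show "x + y \<in> A ` R" if xy: "x \<in> A ` R" "y \<in> A ` R" for x y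
      proof -
        obtain a b where "a \<in> R" "b \<in> R" "x = A a" "y = A b" using xy by blast
        then show ?thesis
          using add[of a b] subspace_add[OF R] by (intro image_eqI[where x = "a + b"]) auto
      qed
      show "c *s x \<in> A ` R" if x: "x \<in> A ` R" for c x
      proof -
        obtain a where "a \<in> R" "x = A a" using x by (elim imageE)
        then show ?thesis
          using scl[of a c] subspace_scale[OF R] by (intro image_eqI[where x = "c *s a"]) auto
      qed
    qed
  qed
  moreover have "A ` R \<subseteq> R" using A by (rule image_subsetI)
  ultimately show ?thesis by simp
qed

text \<open>Symplectic reduction: if \<open>\<beta> x y = 1\<close>, then \<open>V\<close> is the direct sum of the plane spanned by \<open>x\<close>
  and \<open>y\<close> and its orthogonal complement \<open>W\<close>, and \<open>W\<close> has the same radical as \<open>V\<close>.  The dimension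
  drops by two until the form vanishes, when \<open>V\<close> equals its radical.\<close>

lemma alternating_rank_even:
  fixes \<beta> :: "'b \<Rightarrow> 'b \<Rightarrow> 'a"
  assumes V: "subspace V" and X: "finite X" "V \<subseteq> span X"
    and addl: "\<And>x y z. \<lbrakk>x \<in> V; y \<in> V; z \<in> V\<rbrakk> \<Longrightarrow> \<beta> (x + y) z = \<beta> x z + \<beta> y z"
    and addr: "\<And>x y z. \<lbrakk>x \<in> V; y \<in> V; z \<in> V\<rbrakk> \<Longrightarrow> \<beta> z (x + y) = \<beta> z x + \<beta> z y"
    and scll: "\<And>c x y. \<lbrakk>x \<in> V; y \<in> V\<rbrakk> \<Longrightarrow> \<beta> (c *s x) y = c * \<beta> x y"
    and sclr: "\<And>c x y. \<lbrakk>x \<in> V; y \<in> V\<rbrakk> \<Longrightarrow> \<beta> x (c *s y) = c * \<beta> x y"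
    and alt: "\<And>x. x \<in> V \<Longrightarrow> \<beta> x x = 0"
  shows "even (dim V + dim {x \<in> V. \<forall>y\<in>V. \<beta> x y = 0})"
  using V X(2) addl addr scll sclr alt
proof (induction "dim V" arbitrary: V rule: less_induct)
  case less
  note V = less.prems(1) and VX = less.prems(2) and addl = less.prems(3) and addr = less.prems(4)
    and scll = less.prems(5) and sclr = less.prems(6) and alt = less.prems(7)
  show ?case
  proof (cases "\<forall>x\<in>V. \<forall>y\<in>V. \<beta> x y = 0")
    case True
    then have "{x \<in> V. \<forall>y\<in>V. \<beta> x y = 0} = V" by blast
    then show ?thesis by simp
  next
    case False
    then obtain x y0 where x: "x \<in> V" and y0: "y0 \<in> V" "\<beta> x y0 \<noteq> 0" by blast
    define y where "y = (1 / \<beta> x y0) *s y0"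
    have y: "y \<in> V" using V y0 subspace_scale y_def by blast
    have xy: "\<beta> x y = 1" using y0 x by (simp add: y_def sclr)
    have skew: "\<beta> b a = - \<beta> a b" if "a \<in> V" "b \<in> V" for a b
    proof -
      have "0 = \<beta> (a + b) (a + b)" using that V alt by (simp add: subspace_add)
      also have "\<dots> = \<beta> a b + \<beta> b a" using that V addl[of a b "a + b"] addr[of a b a] addr[of a b b] alt[of a] alt[of b]
        by (simp add: subspace_add)
      finally show ?thesis by (simp add: eq_neg_iff_add_eq_0 add.commute)
    qed
    have yx: "\<beta> y x = - 1" using skew[OF x y] xy by simp
    define W where "W = {z \<in> V. \<beta> x z = 0 \<and> \<beta> y z = 0}"
    define P where "P = span {x, y}"
    have W: "subspace W"
      unfolding W_def subspace_def using V x y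
      by (auto simp: addr sclr subspace_add subspace_scale subspace_0)
        (use sclr[of _ x 0] V x y in \<open>force simp: subspace_0\<close>)+
    have P: "subspace P" by (simp add: P_def)
    have P_eq: "\<exists>a b. p = a *s x + b *s y" if "p \<in> P" for p
      using that unfolding P_def span_insert[of x] span_singleton
      by (auto simp: algebra_simps) metis
    have PV: "P \<subseteq> V" using x y V by (simp add: P_def span_minimal)
    have WV: "W \<subseteq> V" by (auto simp: W_def)
    have \<beta>P: "\<beta> x (a *s x + b *s y) = b" "\<beta> y (a *s x + b *s y) = - a" for a b
      using x y V by (simp_all add: addr sclr subspace_scale alt xy yx)
    have int: "W \<inter> P \<subseteq> {0}"
    proof
      fix p assume p: "p \<in> W \<inter> P"
      then obtain a b where "p = a *s x + b *s y" using P_eq by blast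
      then show "p \<in> {0}" using p \<beta>P[of a b] by (simp add: W_def)
    qed
    have V_eq: "V = {w + p | w p. w \<in> W \<and> p \<in> P}"
    proof
      show "{w + p | w p. w \<in> W \<and> p \<in> P} \<subseteq> V"
        using WV PV V by (auto intro!: subspace_add)
      show "V \<subseteq> {w + p | w p. w \<in> W \<and> p \<in> P}"
      proof
        fix z assume z: "z \<in> V"
        \<comment> \<open>The projection of \<open>z\<close> to the plane: \<open>z - p\<close> is orthogonal to \<open>x\<close> and \<open>y\<close>.\<close>
        define p where "p = (- \<beta> y z) *s x + \<beta> x z *s y"
        have pP: "p \<in> P" unfolding p_def P_def
          by (intro span_add span_scale span_base) auto
        have pV: "p \<in> V" using pP PV by blast
        have zp: "z - p \<in> V" using z pV V by (simp add: subspace_diff)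
        have "\<beta> x p = \<beta> x z" "\<beta> y p = \<beta> y z"
          using \<beta>P[of "- \<beta> y z" "\<beta> x z"] unfolding p_def[symmetric] by simp_all
        moreover have "\<beta> x (z - p) + \<beta> x p = \<beta> x z" "\<beta> y (z - p) + \<beta> y p = \<beta> y z"
          using addr[OF zp pV x] addr[OF zp pV y] by simp_all
        ultimately have "z - p \<in> W" using zp unfolding W_def
          by (metis (mono_tags, lifting) add_cancel_left_left mem_Collect_eq)
        moreover have "z = (z - p) + p" by simp
        ultimately show "z \<in> {w + p | w p. w \<in> W \<and> p \<in> P}" using pP by blast
      qed
    qed
    have "x \<notin> span {y}"
    proof
      assume "x \<in> span {y}"
      then obtain k where "x = k *s y" by (auto simp: span_singleton)
      then have "\<beta> x y = 0" using scll[OF y y] alt[OF y] by simp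
      then show False using xy by simp
    qed
    moreover have "y \<noteq> 0"
      using xy sclr[OF x y, of 0] alt[OF x] sclr[OF x x, of 0] by auto
    ultimately have "independent {x, y}" "x \<noteq> y"
      by (auto simp: independent_insert intro: span_base)
    then have "dim P = 2" unfolding P_def using dim_span_eq_card_independent by fastforce
    moreover have "dim V = dim W + dim P"
      using dim_direct_sum[OF W P X(1) _ _ int] V_eq WV PV VX by auto
    moreover have "{z \<in> V. \<forall>t\<in>V. \<beta> z t = 0} = {z \<in> W. \<forall>t\<in>W. \<beta> z t = 0}" (is "?L = ?R")
    proof
      show "?L \<subseteq> ?R"
      proof
        fix z assume z: "z \<in> ?L"
        then have "\<beta> x z = 0" "\<beta> y z = 0" using skew[OF _ x, of z] skew[OF _ y, of z] x y by auto
        then show "z \<in> ?R" using z WV by (auto simp: W_def)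
      qed
      show "?R \<subseteq> ?L"
      proof
        fix z assume z: "z \<in> ?R"
        then have zV: "z \<in> V" and z0: "\<beta> z x = 0" "\<beta> z y = 0"
          using skew[OF x, of z] skew[OF y, of z] by (auto simp: W_def)
        have "\<beta> z t = 0" if t: "t \<in> V" for t
        proof -
          obtain w p where wp: "t = w + p" "w \<in> W" "p \<in> P" using t V_eq by blast
          obtain a b where ab: "p = a *s x + b *s y" using P_eq wp by blast
          have "\<beta> z p = 0" using x y V zV z0 by (simp add: ab addr sclr subspace_scale)
          moreover have "\<beta> z w = 0" using z wp by blast
          ultimately show ?thesis using wp WV PV zV addr[of w p z] by auto
        qed
        then show "z \<in> ?L" using zV by blast
      qed
    qed
    moreover have "even (dim W + dim {z \<in> W. \<forall>t\<in>W. \<beta> z t = 0})"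
    proof (rule less.hyps)
      show "dim W < dim V" using calculation by simp
    qed (use W WV VX in \<open>auto simp: subset_iff addl addr scll sclr alt\<close>)
    ultimately show ?thesis by simp
  qed
qed

end

section \<open>The parity of \<open>dim g(-1)\<^sub>1\<close>\<close>

sublocale lie_superalgebra \<subseteq> L: vector_space "smul g" by (rule vs)

context lie_superalgebra
begin

lemma part_0: "0 \<in> part g i"
  by (rule L.subspace_0[OF part_subspace])

lemma part_lspace: "x \<in> part g i \<Longrightarrow> x \<in> lspace g"
proof (cases i)
  case zero
  assume "x \<in> part g i"
  then have "x + 0 \<in> lspace g" unfolding lspace_def using zero part_0 by blast
  then show ?thesis by simp
next
  case one
  assume "x \<in> part g i"
  then have "0 + x \<in> lspace g" unfolding lspace_def using one part_0 by blast
  then show ?thesis by simp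
qed

lemma subspace_lspace: "L.subspace (lspace g)"
  unfolding lspace_def by (rule L.subspace_sums[OF part_subspace part_subspace])

lemma lspaceE:
  assumes "x \<in> lspace g"
  obtains y z where "x = y + z" "y \<in> part g 0" "z \<in> part g 1"
  using assms unfolding lspace_def by blast

lemma br_lspace:
  assumes "x \<in> lspace g" "y \<in> lspace g" shows "br g x y \<in> lspace g"
proof -
  have 1: "br g a y \<in> lspace g" if a: "a \<in> part g i" for a i
  proof -
    obtain y0 y1 where y: "y = y0 + y1" "y0 \<in> part g 0" "y1 \<in> part g 1"
      using assms(2) by (rule lspaceE)
    show ?thesis
      using y br_part[OF a y(2)] br_part[OF a y(3)] a
      by (simp add: br_add_right part_lspace L.subspace_add[OF subspace_lspace])
  qed
  obtain x0 x1 where x: "x = x0 + x1" "x0 \<in> part g 0" "x1 \<in> part g 1"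
    using assms(1) by (rule lspaceE)
  show ?thesis
    using 1[OF x(2)] 1[OF x(3)] x assms(2)
    by (simp add: br_add_left part_lspace L.subspace_add[OF subspace_lspace])
qed

lemma br_0_left: "y \<in> lspace g \<Longrightarrow> br g 0 y = 0"
  using br_smul_left[of 0 y 0] L.subspace_0[OF subspace_lspace] by simp

lemma br_0_right: "y \<in> lspace g \<Longrightarrow> br g y 0 = 0"
  using br_smul_right[of y 0 0] L.subspace_0[OF subspace_lspace] by simp

lemma br_odd_commute: "x \<in> part g 1 \<Longrightarrow> y \<in> part g 1 \<Longrightarrow> br g x y = br g y x"
  using br_skew[of x 1 y 1] by (simp add: ksign_def)

context
  fixes B :: "'a \<Rightarrow> 'a \<Rightarrow> complex"
  assumes B: "invariant_form g B"
begin

lemma form_add: "\<lbrakk>x \<in> lspace g; y \<in> lspace g; z \<in> lspace g\<rbrakk> \<Longrightarrow> B z (x + y) = B z x + B z y"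
  and form_smul: "\<lbrakk>x \<in> lspace g; y \<in> lspace g\<rbrakk> \<Longrightarrow> B x (smul g c y) = c * B x y"
  and form_smul_left: "\<lbrakk>x \<in> lspace g; y \<in> lspace g\<rbrakk> \<Longrightarrow> B (smul g c x) y = c * B x y"
  and form_even: "\<lbrakk>x \<in> part g 0; y \<in> part g 1\<rbrakk> \<Longrightarrow> B x y = 0 \<and> B y x = 0"
  and form_invariant:
    "\<lbrakk>x \<in> lspace g; y \<in> lspace g; z \<in> lspace g\<rbrakk> \<Longrightarrow> B (br g x y) z = B x (br g y z)"
  using B unfolding invariant_form_def by simp_all

lemma form_nondegenerate: "\<lbrakk>x \<in> lspace g; \<And>y. y \<in> lspace g \<Longrightarrow> B x y = 0\<rbrakk> \<Longrightarrow> x = 0"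
  using B unfolding invariant_form_def by simp

lemma form_0_left: "y \<in> lspace g \<Longrightarrow> B 0 y = 0"
  using form_smul_left[of 0 y 0] L.subspace_0[OF subspace_lspace] by simp

lemma form_0: "y \<in> lspace g \<Longrightarrow> B y 0 = 0"
  using form_smul[of y 0 0] L.subspace_0[OF subspace_lspace] by simp

text \<open>The alternating form is \<open>\<omega> (A x) y\<close>, with \<open>\<omega> x y = \<chi>([x, y])\<close> and \<open>A = ad h + 1\<close>.  The shift by 1
  is half of the weight 2 of \<open>e\<close>: it is what turns \<open>\<omega>([h, x], y) + \<omega>(x, [h, y]) = -2 \<omega>(x, y)\<close>
  into skewness of \<open>A\<close>.  Non-degeneracy of \<open>\<omega>\<close> on \<open>g(-1)\<^sub>1\<close> is read off from the Gram matrix of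
  the basis \<open>v\<close>.\<close>

lemma d1_parity:
  assumes fd: "finite_dimensional g" and e: "e \<in> part g 0" and h: "h \<in> part g 0"
    and he: "br g h e = smul g 2 e" and ad: "adapted_bases g h (B e) s u r v"
  shows "even (d1 g e - int r)"
proof -
  define V where "V = part g 1"
  define R where "R = centralizer g e \<inter> V"
  define K where "K = eigenspace g h (- 1) \<inter> V"
  define A where "A = (\<lambda>x. br g h x + x)"
  define \<omega> where "\<omega> = (\<lambda>x y. B e (br g x y))"
  obtain X where X: "finite X" "lspace g \<subseteq> L.span X"
    using fd unfolding finite_dimensional_def by blast
  have V: "L.subspace V" by (simp add: V_def part_subspace)
  have VL: "x \<in> lspace g" if "x \<in> V" for x using that part_lspace by (simp add: V_def)
  have VX: "V \<subseteq> L.span X" using VL X by blast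
  have eL: "e \<in> lspace g" and hL: "h \<in> lspace g" using e h part_lspace by blast+
  have hV: "br g h x \<in> V" if "x \<in> V" for x
    using br_part[OF h, of x 1] that by (simp add: V_def)
  have AV: "A x \<in> V" if "x \<in> V" for x
    using that hV by (simp add: A_def L.subspace_add[OF V])
  have A_add: "A (x + y) = A x + A y" if "x \<in> V" "y \<in> V" for x y
    using that VL hL by (simp add: A_def br_add_right algebra_simps)
  have A_smul: "A (smul g c x) = smul g c (A x)" if "x \<in> V" for c x
    using that VL hL by (simp add: A_def br_smul_right L.scale_right_distrib)
  have brL: "br g x y \<in> lspace g" if "x \<in> V" "y \<in> V" for x y
    using that VL br_lspace by blast
  have \<omega>_add: "\<omega> (x + y) z = \<omega> x z + \<omega> y z" if "x \<in> V" "y \<in> V" "z \<in> V" for x y z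
    using that VL eL brL by (simp add: \<omega>_def br_add_left form_add)
  have \<omega>_smul: "\<omega> (smul g c x) y = c * \<omega> x y" if "x \<in> V" "y \<in> V" for c x y
    using that VL eL brL by (simp add: \<omega>_def br_smul_left form_smul)
  have \<omega>_sym: "\<omega> x y = \<omega> y x" if "x \<in> V" "y \<in> V" for x y
    using that br_odd_commute by (simp add: \<omega>_def V_def)
  have \<omega>_eq: "\<omega> x y = B (br g e x) y" if "x \<in> V" "y \<in> V" for x y
    using that VL eL by (simp add: \<omega>_def form_invariant)
  have \<omega>_skew: "\<omega> (A x) y = - \<omega> x (A y)" if xy: "x \<in> V" "y \<in> V" for x y
  proof -
    have "br g e h = smul g (- 2) e"
      using br_skew[OF e h] he by (simp add: ksign_def)
    then have "B e (br g h (br g x y)) = - 2 * \<omega> x y"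
      using form_invariant[OF eL hL brL[OF xy]] form_smul_left[OF eL brL[OF xy], of "- 2"]
      by (simp add: \<omega>_def)
    moreover have "br g h (br g x y) = br g (br g h x) y + br g x (br g h y)"
      using jacobi[OF h, of x 1 y 1] xy by (simp add: V_def ksign_def)
    ultimately have "\<omega> (br g h x) y + \<omega> x (br g h y) = - 2 * \<omega> x y"
      using brL xy hV eL by (simp add: \<omega>_def form_add)
    moreover have "\<omega> (A x) y = \<omega> (br g h x) y + \<omega> x y"
      using xy hV by (simp add: A_def \<omega>_add)
    moreover have "\<omega> x (A y) = \<omega> x (br g h y) + \<omega> x y"
      using xy hV \<omega>_sym[of x "A y"] \<omega>_sym[of x "br g h y"] \<omega>_sym[of x y] AV
      by (simp add: A_def \<omega>_add)
    ultimately show ?thesis by (simp add: algebra_simps)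
  qed
  have R: "L.subspace R"
    unfolding R_def centralizer_def
    using subspace_lspace V eL VL by (auto simp: L.subspace_def br_add_right br_smul_right br_0_right)
  have RV: "R \<subseteq> V" by (auto simp: R_def)
  have R_eq: "R = {x \<in> V. \<forall>y\<in>V. \<omega> x y = 0}"
  proof
    show "R \<subseteq> {x \<in> V. \<forall>y\<in>V. \<omega> x y = 0}"
      using VL by (auto simp: R_def \<omega>_eq centralizer_def form_0_left)
    show "{x \<in> V. \<forall>y\<in>V. \<omega> x y = 0} \<subseteq> R"
    proof
      fix x assume x: "x \<in> {x \<in> V. \<forall>y\<in>V. \<omega> x y = 0}"
      have ex: "br g e x \<in> part g 1" using br_part[OF e, of x 1] x by (simp add: V_def)
      have "br g e x = 0"
      proof (rule form_nondegenerate)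
        show "br g e x \<in> lspace g" using ex part_lspace by blast
        fix y assume "y \<in> lspace g"
        then obtain y0 y1 where y: "y = y0 + y1" "y0 \<in> part g 0" "y1 \<in> part g 1"
          by (rule lspaceE)
        have "B (br g e x) y1 = 0" using x y \<omega>_eq[of x y1] by (simp add: V_def)
        moreover have "B (br g e x) y0 = 0" using form_even[OF y(2) ex] by simp
        ultimately show "B (br g e x) y = 0"
          using y ex part_lspace by (simp add: form_add)
      qed
      then show "x \<in> R" using x VL by (simp add: R_def centralizer_def)
    qed
  qed
  have K_eq: "K = {x \<in> V. A x = 0}"
    using VL by (auto simp: K_def eigenspace_def A_def eq_neg_iff_add_eq_0)
  have K: "L.subspace K"
    unfolding K_eq L.subspace_def using V A_smul[of 0 0]
    by (auto simp: A_add A_smul L.subspace_add L.subspace_scale L.subspace_0)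
  have v_inj: "inj_on v {1..r}" and v_ind: "L.independent (v ` {1..r})"
    and v_span: "L.span (v ` {1..r}) = K"
    using ad unfolding adapted_bases_def indexed_basis_def K_def V_def by auto
  have v_gram: "\<omega> (v i) (v j) = (if i + j = r + 1 then 1 else 0)" if "i \<in> {1..r}" "j \<in> {1..r}" for i j
    using ad that unfolding adapted_bases_def \<omega>_def by blast
  have vV: "v i \<in> V" if "i \<in> {1..r}" for i
    using that L.span_base[of "v i" "v ` {1..r}"] v_span by (auto simp: K_def)
  have dimK: "L.dim K = r"
    unfolding v_span[symmetric]
    using L.dim_span_eq_card_independent[OF v_ind] card_image[OF v_inj] by simp
  have KR: "K \<inter> R \<subseteq> {0}"
  proof
    fix x assume x: "x \<in> K \<inter> R"
    then have "x \<in> range (\<lambda>c. \<Sum>b\<in>v ` {1..r}. smul g (c b) b)"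
      unfolding v_span[symmetric] by (simp add: L.span_finite)
    then obtain c where "x = (\<Sum>b\<in>v ` {1..r}. smul g (c b) b)" by (rule imageE)
    then have xc: "x = (\<Sum>i\<in>{1..r}. smul g (c (v i)) (v i))"
      by (simp only: sum.reindex[OF v_inj] o_def)
    have \<omega>_sum: "(\<Sum>i\<in>I. smul g (c (v i)) (v i)) \<in> V \<and>
        \<omega> (\<Sum>i\<in>I. smul g (c (v i)) (v i)) y = (\<Sum>i\<in>I. c (v i) * \<omega> (v i) y)"
      if "I \<subseteq> {1..r}" "y \<in> V" for I y
      using finite_subset[OF that(1) finite_atLeastAtMost] that
    proof (induction I rule: finite_induct)
      case empty
      then show ?case using \<omega>_smul[of 0 y 0] V by (simp add: L.subspace_0)
    next
      case (insert i I)
      define S where "S = (\<Sum>i\<in>I. smul g (c (v i)) (v i))"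
      have i: "v i \<in> V" using vV insert.prems by simp
      have S: "S \<in> V" "\<omega> S y = (\<Sum>i\<in>I. c (v i) * \<omega> (v i) y)"
        using insert.IH insert.prems unfolding S_def by auto
      have "(\<Sum>i\<in>insert i I. smul g (c (v i)) (v i)) = smul g (c (v i)) (v i) + S"
        using insert.hyps by (simp add: S_def)
      moreover have "smul g (c (v i)) (v i) \<in> V" by (rule L.subspace_scale[OF V i])
      ultimately show ?case
        using insert.hyps insert.prems S i by (simp add: \<omega>_add \<omega>_smul L.subspace_add[OF V])
    qed
    have "c (v j) = 0" if j: "j \<in> {1..r}" for j
    proof -
      have j': "r + 1 - j \<in> {1..r}" using j by auto
      have "0 = \<omega> x (v (r + 1 - j))" using x vV[OF j'] by (simp add: R_eq)
      also have "\<dots> = (\<Sum>i\<in>{1..r}. c (v i) * \<omega> (v i) (v (r + 1 - j)))"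
        using \<omega>_sum[OF subset_refl vV[OF j']] xc by simp
      also have "\<dots> = (\<Sum>i\<in>{1..r}. if i = j then c (v i) else 0)"
      proof (rule sum.cong[OF refl])
        fix i assume i: "i \<in> {1..r}"
        have "i + (r + 1 - j) = r + 1 \<longleftrightarrow> i = j" using j by auto
        then show "c (v i) * \<omega> (v i) (v (r + 1 - j)) = (if i = j then c (v i) else 0)"
          by (simp only: v_gram[OF i j']) simp
      qed
      also have "\<dots> = c (v j)" using j by (subst sum.delta) auto
      finally show ?thesis by simp
    qed
    then have "x = (\<Sum>i\<in>{1..r}. 0)" unfolding xc by (intro sum.cong) auto
    then show "x \<in> {0}" by simp
  qed
  have AR: "A x \<in> R" if "x \<in> R" for x
    using that AV \<omega>_skew unfolding R_eq by auto
  have A_surj: "A ` R = R"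
  proof (rule L.injective_imp_surjective_on[OF R X(1)])
    show "R \<subseteq> L.span X" using RV VX by blast
    show "x = 0" if "x \<in> R" "A x = 0" for x
      using that KR RV K_eq by blast
  qed (use RV in \<open>simp_all add: AR A_add A_smul subset_iff\<close>)
  have rad: "{x \<in> V. \<forall>y\<in>V. \<omega> (A x) y = 0} = {x + y | x y. x \<in> K \<and> y \<in> R}"
  proof
    show "{x + y | x y. x \<in> K \<and> y \<in> R} \<subseteq> {x \<in> V. \<forall>y\<in>V. \<omega> (A x) y = 0}"
    proof clarify
      fix x y assume x: "x \<in> K" and y: "y \<in> R"
      then have "A (x + y) = A y" "x + y \<in> V"
        using RV by (auto simp: K_eq A_add L.subspace_add[OF V])
      then show "x + y \<in> V \<and> (\<forall>z\<in>V. \<omega> (A (x + y)) z = 0)"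
        using AR[OF y] by (simp add: R_eq)
    qed
    show "{x \<in> V. \<forall>y\<in>V. \<omega> (A x) y = 0} \<subseteq> {x + y | x y. x \<in> K \<and> y \<in> R}"
    proof
      fix x assume x: "x \<in> {x \<in> V. \<forall>y\<in>V. \<omega> (A x) y = 0}"
      then have "A x \<in> R" using AV by (simp add: R_eq)
      \<comment> \<open>Correcting \<open>x\<close> by this \<open>y\<close> leaves an element of the kernel of \<open>A\<close>.\<close>
      then obtain y where y: "y \<in> R" "A y = A x" using A_surj by (metis imageE)
      have xV: "x \<in> V" and yV: "y \<in> V" using x y RV by auto
      have xyV: "x - y \<in> V" using xV yV by (rule L.subspace_diff[OF V])
      have "A (x - y) + A y = A x" using A_add[OF xyV yV] by simp
      then have "x - y \<in> K" using y(2) xyV by (simp add: K_eq)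
      moreover have "x = (x - y) + y" by simp
      ultimately show "x \<in> {x + y | x y. x \<in> K \<and> y \<in> R}" using y by blast
    qed
  qed
  have "even (L.dim V + L.dim {x \<in> V. \<forall>y\<in>V. \<omega> (A x) y = 0})"
  proof (rule L.alternating_rank_even[OF V X(1) VX])
    fix x y z c assume [simp]: "x \<in> V" "y \<in> V"
    show "\<omega> (A (smul g c x)) y = c * \<omega> (A x) y"
      by (simp add: A_smul \<omega>_smul AV)
    show "\<omega> (A x) (smul g c y) = c * \<omega> (A x) y"
      using \<omega>_sym[of "A x"] by (simp add: \<omega>_smul AV L.subspace_scale[OF V])
    assume [simp]: "z \<in> V"
    show "\<omega> (A (x + y)) z = \<omega> (A x) z + \<omega> (A y) z"
      by (simp add: A_add \<omega>_add AV)
    show "\<omega> (A z) (x + y) = \<omega> (A z) x + \<omega> (A z) y"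
      using \<omega>_sym[of "A z"] by (simp add: \<omega>_add AV L.subspace_add[OF V])
  next
    fix x assume "x \<in> V"
    then have "\<omega> (A x) x = - \<omega> (A x) x" using \<omega>_skew[of x x] \<omega>_sym[of x "A x"] AV by simp
    then show "\<omega> (A x) x = 0" by simp
  qed
  moreover have "L.dim {x + y | x y. x \<in> K \<and> y \<in> R} = r + L.dim R"
    using L.dim_direct_sum[OF K R X(1) _ _ KR] dimK VX RV by (auto simp: K_def)
  ultimately have "even (L.dim V + (r + L.dim R))" by (simp only: rad)
  then have "even (int (L.dim V + (r + L.dim R)))" by (simp only: even_of_nat)
  then show ?thesis
    unfolding d1_def R_def V_def by simp blast
qed

end

end

section \<open>Tensor products\<close>

text \<open>Just enough structure on \<open>R\<close>, \<open>M\<close> and \<open>N\<close> for the quotient of the free abelian group on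
  \<open>M \<times> N\<close> by the tensor relations to make sense.\<close>

locale tensor_factors =
  fixes R :: "'r set" and M :: "('m, 'x) ring_scheme" and N :: "('n, 'y) ring_scheme"
    and ra :: "'m \<Rightarrow> 'r \<Rightarrow> 'm" and la :: "'r \<Rightarrow> 'n \<Rightarrow> 'n"
  assumes M: "abelian_group M" and N: "abelian_group N"
    and ra_closed: "\<lbrakk>m \<in> carrier M; y \<in> R\<rbrakk> \<Longrightarrow> ra m y \<in> carrier M"
    and la_closed: "\<lbrakk>y \<in> R; n \<in> carrier N\<rbrakk> \<Longrightarrow> la y n \<in> carrier N"
begin

abbreviation pairs where "pairs \<equiv> free_Abelian_group (carrier M \<times> carrier N)"
abbreviation rels where "rels \<equiv> tensor_rels R M N ra la"
abbreviation tensor where "tensor \<equiv> tensor_product R M N ra la"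

definition tens :: "'m \<Rightarrow> 'n \<Rightarrow> ('m \<times> 'n \<Rightarrow>\<^sub>0 int) set" where
  "tens m n = rels #>\<^bsub>pairs\<^esub> frag_of (m, n)"

definition rel_gens :: "('m \<times> 'n \<Rightarrow>\<^sub>0 int) set" where
  "rel_gens =
     {frag_of (m \<oplus>\<^bsub>M\<^esub> m', n) - frag_of (m, n) - frag_of (m', n) | m m' n.
         m \<in> carrier M \<and> m' \<in> carrier M \<and> n \<in> carrier N} \<union>
     {frag_of (m, n \<oplus>\<^bsub>N\<^esub> n') - frag_of (m, n) - frag_of (m, n') | m n n'.
         m \<in> carrier M \<and> n \<in> carrier N \<and> n' \<in> carrier N} \<union>
     {frag_of (ra m y, n) - frag_of (m, la y n) | m y n.
         m \<in> carrier M \<and> y \<in> R \<and> n \<in> carrier N}"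

lemma rels_eq_generate: "rels = generate pairs rel_gens"
  unfolding tensor_rels_def rel_gens_def ..

lemma frag_diff_closed: "\<lbrakk>a \<in> carrier pairs; b \<in> carrier pairs\<rbrakk> \<Longrightarrow> a - b \<in> carrier pairs"
  using keys_diff[of a b] by auto

lemma frag_add_closed: "\<lbrakk>a \<in> carrier pairs; b \<in> carrier pairs\<rbrakk> \<Longrightarrow> a + b \<in> carrier pairs"
  using keys_add[of a b] by auto

lemma frag_of_closed: "\<lbrakk>m \<in> carrier M; n \<in> carrier N\<rbrakk> \<Longrightarrow> frag_of (m, n) \<in> carrier pairs"
  by simp

lemma rel_gens_carrier: "rel_gens \<subseteq> carrier pairs"
proof -
  have "m \<oplus>\<^bsub>M\<^esub> m' \<in> carrier M" if "m \<in> carrier M" "m' \<in> carrier M" for m m'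
    using abelian_groupE(1)[OF M] that by blast
  moreover have "n \<oplus>\<^bsub>N\<^esub> n' \<in> carrier N" if "n \<in> carrier N" "n' \<in> carrier N" for n n'
    using abelian_groupE(1)[OF N] that by blast
  ultimately show ?thesis
    unfolding rel_gens_def
    by (intro Un_least subsetI; clarify; intro frag_diff_closed frag_of_closed)
      (simp_all add: ra_closed la_closed)
qed

lemma rels_subgroup: "subgroup rels pairs"
  unfolding rels_eq_generate by (rule group.generate_is_subgroup[OF group_free_Abelian_group rel_gens_carrier])

lemma rels_normal: "rels \<lhd> pairs"
  by (rule comm_group.normal_iff_subgroup[OF abelian_free_Abelian_group, THEN iffD2, OF rels_subgroup])

lemma comm_group_tensor: "comm_group tensor"
  unfolding tensor_product_def
  by (rule comm_group.abelian_FactGroup[OF abelian_free_Abelian_group rels_subgroup])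

lemma group_tensor: "group tensor"
  using comm_group_tensor by (simp add: comm_group_def)

lemma proj_hom: "(\<lambda>t. rels #>\<^bsub>pairs\<^esub> t) \<in> hom pairs tensor"
  unfolding tensor_product_def by (rule normal.r_coset_hom_Mod[OF rels_normal])

lemma carrier_tensor: "carrier tensor = (\<lambda>t. rels #>\<^bsub>pairs\<^esub> t) ` carrier pairs"
  unfolding tensor_product_def by (rule carrier_FactGroup)

lemma carrier_tensorE:
  assumes "q \<in> carrier tensor"
  obtains t where "t \<in> carrier pairs" "q = rels #>\<^bsub>pairs\<^esub> t"
  using assms unfolding carrier_tensor by (rule imageE)

lemma proj_add:
  "\<lbrakk>a \<in> carrier pairs; b \<in> carrier pairs\<rbrakk> \<Longrightarrow> rels #>\<^bsub>pairs\<^esub> (a + b) = (rels #>\<^bsub>pairs\<^esub> a) \<otimes>\<^bsub>tensor\<^esub> (rels #>\<^bsub>pairs\<^esub> b)"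
  using hom_mult[OF proj_hom, of a b] by simp

lemma proj_eqI:
  assumes "a \<in> carrier pairs" "b \<in> carrier pairs" "a - b \<in> rels"
  shows "rels #>\<^bsub>pairs\<^esub> a = rels #>\<^bsub>pairs\<^esub> b"
proof -
  have "a \<in> rels #>\<^bsub>pairs\<^esub> b"
    using assms by (auto simp: r_coset_def intro!: bexI[of _ "a - b"])
  then show ?thesis
    using group.repr_independence[OF group_free_Abelian_group _ assms(2) rels_subgroup] by metis
qed

lemma tens_closed: "\<lbrakk>m \<in> carrier M; n \<in> carrier N\<rbrakk> \<Longrightarrow> tens m n \<in> carrier tensor"
  unfolding tens_def carrier_tensor by (intro imageI) simp

lemma rel_gens_rels: "t \<in> rel_gens \<Longrightarrow> t \<in> rels"
  unfolding rels_eq_generate by (rule generate.incl)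

lemma tens_add_left:
  assumes "m \<in> carrier M" "m' \<in> carrier M" "n \<in> carrier N"
  shows "tens (m \<oplus>\<^bsub>M\<^esub> m') n = tens m n \<otimes>\<^bsub>tensor\<^esub> tens m' n"
proof -
  have "frag_of (m \<oplus>\<^bsub>M\<^esub> m', n) - (frag_of (m, n) + frag_of (m', n)) \<in> rels"
    using assms by (intro rel_gens_rels) (auto simp: rel_gens_def diff_diff_eq)
  moreover have "m \<oplus>\<^bsub>M\<^esub> m' \<in> carrier M" using abelian_groupE(1)[OF M] assms by blast
  ultimately show ?thesis
    unfolding tens_def using assms
    by (subst proj_add[symmetric]; (intro proj_eqI)?) (simp_all only: frag_of_closed frag_add_closed)
qed

lemma tens_add_right:
  assumes "m \<in> carrier M" "n \<in> carrier N" "n' \<in> carrier N"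
  shows "tens m (n \<oplus>\<^bsub>N\<^esub> n') = tens m n \<otimes>\<^bsub>tensor\<^esub> tens m n'"
proof -
  have "frag_of (m, n \<oplus>\<^bsub>N\<^esub> n') - (frag_of (m, n) + frag_of (m, n')) \<in> rels"
    using assms by (intro rel_gens_rels) (auto simp: rel_gens_def diff_diff_eq)
  moreover have "n \<oplus>\<^bsub>N\<^esub> n' \<in> carrier N" using abelian_groupE(1)[OF N] assms by blast
  ultimately show ?thesis
    unfolding tens_def using assms
    by (subst proj_add[symmetric]; (intro proj_eqI)?) (simp_all only: frag_of_closed frag_add_closed)
qed

lemma tens_balanced:
  assumes "m \<in> carrier M" "y \<in> R" "n \<in> carrier N"
  shows "tens (ra m y) n = tens m (la y n)"
  unfolding tens_def using assms
  by (intro proj_eqI rel_gens_rels) (auto simp: rel_gens_def ra_closed la_closed)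

lemma tens_zero_right:
  assumes "m \<in> carrier M" shows "tens m \<zero>\<^bsub>N\<^esub> = \<one>\<^bsub>tensor\<^esub>"
proof -
  interpret N: abelian_group N by (rule N)
  interpret tensor: group tensor by (rule group_tensor)
  have "tens m \<zero>\<^bsub>N\<^esub> \<otimes>\<^bsub>tensor\<^esub> tens m \<zero>\<^bsub>N\<^esub> = tens m \<zero>\<^bsub>N\<^esub>"
    using tens_add_right[OF assms N.zero_closed N.zero_closed] by simp
  then show ?thesis using tens_closed[OF assms N.zero_closed] by simp
qed

text \<open>Pure tensors generate the tensor product.\<close>

lemma hom_eq_on_tens:
  assumes G: "group G" and f: "f \<in> hom tensor G" and f': "f' \<in> hom tensor G"
    and eq: "\<And>m n. \<lbrakk>m \<in> carrier M; n \<in> carrier N\<rbrakk> \<Longrightarrow> f (tens m n) = f' (tens m n)"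
    and q: "q \<in> carrier tensor"
  shows "f q = f' q"
proof -
  interpret f: group_hom tensor G f using group_tensor G f by (simp add: group_hom_def group_hom_axioms_def)
  interpret f': group_hom tensor G f' using group_tensor G f' by (simp add: group_hom_def group_hom_axioms_def)
  interpret p: group_hom pairs tensor "\<lambda>t. rels #>\<^bsub>pairs\<^esub> t"
    using group_tensor proj_hom by (simp add: group_hom_def group_hom_axioms_def)
  obtain t where t: "t \<in> carrier pairs" "q = rels #>\<^bsub>pairs\<^esub> t" using q by (rule carrier_tensorE)
  from t(1) have "Poly_Mapping.keys t \<subseteq> carrier M \<times> carrier N" by simp
  then have "f (rels #>\<^bsub>pairs\<^esub> t) = f' (rels #>\<^bsub>pairs\<^esub> t)"
  proof (induction rule: free_Abelian_group_induct[consumes 1])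
    case 1
    have "rels #>\<^bsub>pairs\<^esub> 0 = \<one>\<^bsub>tensor\<^esub>" using p.hom_one by simp
    then show ?case by (simp only: f.hom_one f'.hom_one)
  next
    case (2 x y)
    have y: "rels #>\<^bsub>pairs\<^esub> y \<in> carrier tensor" and x: "rels #>\<^bsub>pairs\<^esub> x \<in> carrier tensor" using 2 by simp_all
    have "rels #>\<^bsub>pairs\<^esub> (x - y) = (rels #>\<^bsub>pairs\<^esub> x) \<otimes>\<^bsub>tensor\<^esub> inv\<^bsub>tensor\<^esub> (rels #>\<^bsub>pairs\<^esub> y)"
      using 2 p.hom_inv[of y] proj_add[of x "- y"] by simp
    then show ?case using 2 x y by simp
  next
    case (3 a)
    then show ?case using eq unfolding tens_def by auto
  qed
  then show ?thesis using t by simp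
qed

text \<open>For additive \<open>\<phi>\<close> compatible with the middle action, this is \<open>m \<otimes> n \<mapsto> \<phi> m \<otimes> n\<close>.  The action of
  \<open>U(g)\<close> on \<open>Q\<^sub>\<chi>\<close> is the case of left multiplications; the endomorphism sought is the case of a
  right multiplication.\<close>

definition tens_map :: "('m \<Rightarrow> 'm) \<Rightarrow> ('m \<times> 'n \<Rightarrow>\<^sub>0 int) set \<Rightarrow> ('m \<times> 'n \<Rightarrow>\<^sub>0 int) set" where
  "tens_map \<phi> q = the_elem
     ((\<lambda>t. rels #>\<^bsub>pairs\<^esub> frag_extend (\<lambda>(m, n). frag_of (\<phi> m, n)) t) ` q)"

context
  fixes \<phi> :: "'m \<Rightarrow> 'm"
  assumes \<phi>_closed: "\<And>m. m \<in> carrier M \<Longrightarrow> \<phi> m \<in> carrier M"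
    and \<phi>_add: "\<And>m m'. \<lbrakk>m \<in> carrier M; m' \<in> carrier M\<rbrakk> \<Longrightarrow> \<phi> (m \<oplus>\<^bsub>M\<^esub> m') = \<phi> m \<oplus>\<^bsub>M\<^esub> \<phi> m'"
    \<comment> \<open>Only the image of \<open>\<phi>\<close> in the tensor product has to be compatible with the action of \<open>R\<close>.\<close>
    and \<phi>_balanced: "\<And>m y n. \<lbrakk>m \<in> carrier M; y \<in> R; n \<in> carrier N\<rbrakk> \<Longrightarrow>
       tens (\<phi> (ra m y)) n = tens (\<phi> m) (la y n)"
begin

abbreviation \<psi> where "\<psi> \<equiv> frag_extend (\<lambda>(m, n). frag_of (\<phi> m, n))"

lemma \<psi>_closed: "t \<in> carrier pairs \<Longrightarrow> \<psi> t \<in> carrier pairs"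
  using keys_frag_extend[of "\<lambda>(m, n). frag_of (\<phi> m, n)" t] \<phi>_closed
  by (fastforce simp: keys_frag_of)

lemma \<psi>_hom: "(\<lambda>t. rels #>\<^bsub>pairs\<^esub> \<psi> t) \<in> hom pairs tensor"
proof (rule homI)
  show "rels #>\<^bsub>pairs\<^esub> \<psi> t \<in> carrier tensor" if "t \<in> carrier pairs" for t
    using \<psi>_closed[OF that] unfolding carrier_tensor by (rule imageI)
  show "rels #>\<^bsub>pairs\<^esub> \<psi> (t \<otimes>\<^bsub>pairs\<^esub> t') = (rels #>\<^bsub>pairs\<^esub> \<psi> t) \<otimes>\<^bsub>tensor\<^esub> (rels #>\<^bsub>pairs\<^esub> \<psi> t')"
    if "t \<in> carrier pairs" "t' \<in> carrier pairs" for t t'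
    using proj_add[OF \<psi>_closed[OF that(1)] \<psi>_closed[OF that(2)]] by (simp add: frag_extend_add)
qed

text \<open>The induced map on the free group sends every generating relation to zero in the tensor
  product, hence all relations.\<close>

lemma \<psi>_rels:
  assumes "t \<in> rels" shows "rels #>\<^bsub>pairs\<^esub> \<psi> t = \<one>\<^bsub>tensor\<^esub>"
proof -
  interpret h: group_hom pairs tensor "\<lambda>t. rels #>\<^bsub>pairs\<^esub> \<psi> t"
    using group_tensor \<psi>_hom by (simp add: group_hom_def group_hom_axioms_def)
  have diff: "rels #>\<^bsub>pairs\<^esub> \<psi> (a - b) = \<one>\<^bsub>tensor\<^esub>"
    if "a \<in> carrier pairs" "b \<in> carrier pairs" "rels #>\<^bsub>pairs\<^esub> \<psi> a = rels #>\<^bsub>pairs\<^esub> \<psi> b" for a b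
    using h.hom_inv[OF that(2)] h.hom_mult[of a "- b"] that
      h.H.r_inv[OF h.hom_closed[OF that(2)]] by simp
  have pairs: "rels #>\<^bsub>pairs\<^esub> \<psi> (frag_of (m, n)) = tens (\<phi> m) n" for m n
    by (simp add: tens_def)
  have add_closed: "m \<oplus>\<^bsub>M\<^esub> m' \<in> carrier M" if "m \<in> carrier M" "m' \<in> carrier M" for m m'
    using abelian_groupE(1)[OF M] that by blast
  have add_closed': "n \<oplus>\<^bsub>N\<^esub> n' \<in> carrier N" if "n \<in> carrier N" "n' \<in> carrier N" for n n'
    using abelian_groupE(1)[OF N] that by blast
  have "rels #>\<^bsub>pairs\<^esub> \<psi> t = \<one>\<^bsub>tensor\<^esub>" if "t \<in> rel_gens" for t
  proof -
    consider (left) m m' n where "m \<in> carrier M" "m' \<in> carrier M" "n \<in> carrier N"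
        "t = frag_of (m \<oplus>\<^bsub>M\<^esub> m', n) - (frag_of (m, n) + frag_of (m', n))"
      | (right) m n n' where "m \<in> carrier M" "n \<in> carrier N" "n' \<in> carrier N"
        "t = frag_of (m, n \<oplus>\<^bsub>N\<^esub> n') - (frag_of (m, n) + frag_of (m, n'))"
      | (bal) m y n where "m \<in> carrier M" "y \<in> R" "n \<in> carrier N"
        "t = frag_of (ra m y, n) - frag_of (m, la y n)"
      using \<open>t \<in> rel_gens\<close> unfolding rel_gens_def by (auto simp: diff_diff_eq)
    then show ?thesis
    proof cases
      case left
      show ?thesis unfolding left(4)
      proof (rule diff)
        show "rels #>\<^bsub>pairs\<^esub> \<psi> (frag_of (m \<oplus>\<^bsub>M\<^esub> m', n)) = rels #>\<^bsub>pairs\<^esub> \<psi> (frag_of (m, n) + frag_of (m', n))"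
          using left h.hom_mult[of "frag_of (m, n)" "frag_of (m', n)"]
          by (simp add: pairs \<phi>_add tens_add_left \<phi>_closed del: frag_extend_of)
      qed (use left add_closed in \<open>simp_all only: frag_of_closed frag_add_closed\<close>)
    next
      case right
      show ?thesis unfolding right(4)
      proof (rule diff)
        show "rels #>\<^bsub>pairs\<^esub> \<psi> (frag_of (m, n \<oplus>\<^bsub>N\<^esub> n')) = rels #>\<^bsub>pairs\<^esub> \<psi> (frag_of (m, n) + frag_of (m, n'))"
          using right h.hom_mult[of "frag_of (m, n)" "frag_of (m, n')"]
          by (simp add: pairs tens_add_right \<phi>_closed del: frag_extend_of)
      qed (use right add_closed' in \<open>simp_all only: frag_of_closed frag_add_closed\<close>)
    next
      case bal
      show ?thesis unfolding bal(4)
      proof (rule diff)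
        show "rels #>\<^bsub>pairs\<^esub> \<psi> (frag_of (ra m y, n)) = rels #>\<^bsub>pairs\<^esub> \<psi> (frag_of (m, la y n))"
          using bal by (simp add: pairs \<phi>_balanced del: frag_extend_of)
      qed (use bal in \<open>auto simp: ra_closed la_closed\<close>)
    qed
  qed
  then have "rel_gens \<subseteq> kernel pairs tensor (\<lambda>t. rels #>\<^bsub>pairs\<^esub> \<psi> t)"
    using rel_gens_carrier unfolding kernel_def by blast
  then have "generate pairs rel_gens \<subseteq> kernel pairs tensor (\<lambda>t. rels #>\<^bsub>pairs\<^esub> \<psi> t)"
    by (rule h.G.generate_subgroup_incl[OF _ h.subgroup_kernel])
  then have "rels \<subseteq> kernel pairs tensor (\<lambda>t. rels #>\<^bsub>pairs\<^esub> \<psi> t)" by (simp only: rels_eq_generate[symmetric])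
  then show ?thesis using assms by (auto simp: kernel_def)
qed

lemma tens_map_proj:
  assumes t: "t \<in> carrier pairs"
  shows "tens_map \<phi> (rels #>\<^bsub>pairs\<^esub> t) = rels #>\<^bsub>pairs\<^esub> \<psi> t"
proof -
  have "rels #>\<^bsub>pairs\<^esub> \<psi> t' = rels #>\<^bsub>pairs\<^esub> \<psi> t" if "t' \<in> rels #>\<^bsub>pairs\<^esub> t" for t'
  proof -
    obtain k where k: "k \<in> rels" "t' = k \<otimes>\<^bsub>pairs\<^esub> t" using \<open>t' \<in> rels #>\<^bsub>pairs\<^esub> t\<close> unfolding r_coset_def by blast
    have "k \<in> carrier pairs" using subgroup.mem_carrier[OF rels_subgroup k(1)] .
    then show ?thesis
      using hom_mult[OF \<psi>_hom _ t, of k] \<psi>_rels[OF k(1)] k(2) monoid.l_one[OF group.is_monoid[OF group_tensor]]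
        hom_in_carrier[OF \<psi>_hom t] by metis
  qed
  moreover have "t \<in> rels #>\<^bsub>pairs\<^esub> t"
    by (rule group.rcos_self[OF group_free_Abelian_group t rels_subgroup])
  ultimately have "(\<lambda>t. rels #>\<^bsub>pairs\<^esub> \<psi> t) ` (rels #>\<^bsub>pairs\<^esub> t) = {rels #>\<^bsub>pairs\<^esub> \<psi> t}" by blast
  then show ?thesis by (simp add: tens_map_def)
qed

lemma tens_map_hom: "tens_map \<phi> \<in> hom tensor tensor"
proof (rule homI)
  show "tens_map \<phi> q \<in> carrier tensor" if q: "q \<in> carrier tensor" for q
  proof -
    obtain t where "t \<in> carrier pairs" "q = rels #>\<^bsub>pairs\<^esub> t" using q by (rule carrier_tensorE)
    then show ?thesis using tens_map_proj hom_in_carrier[OF \<psi>_hom] by metis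
  qed
  show "tens_map \<phi> (q \<otimes>\<^bsub>tensor\<^esub> q') = tens_map \<phi> q \<otimes>\<^bsub>tensor\<^esub> tens_map \<phi> q'"
    if q: "q \<in> carrier tensor" "q' \<in> carrier tensor" for q q'
  proof -
    obtain t where t: "t \<in> carrier pairs" "q = rels #>\<^bsub>pairs\<^esub> t" using q(1) by (rule carrier_tensorE)
    obtain t' where t': "t' \<in> carrier pairs" "q' = rels #>\<^bsub>pairs\<^esub> t'" using q(2) by (rule carrier_tensorE)
    have "q \<otimes>\<^bsub>tensor\<^esub> q' = rels #>\<^bsub>pairs\<^esub> (t \<otimes>\<^bsub>pairs\<^esub> t')" using t t' proj_add by simp
    moreover have "t \<otimes>\<^bsub>pairs\<^esub> t' \<in> carrier pairs"
      by (rule monoid.m_closed[OF group.is_monoid[OF group_free_Abelian_group] t(1) t'(1)])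
    ultimately show ?thesis
      using tens_map_proj t t' hom_mult[OF \<psi>_hom t(1) t'(1)] by metis
  qed
qed

lemma tens_map_tens: "\<lbrakk>m \<in> carrier M; n \<in> carrier N\<rbrakk> \<Longrightarrow> tens_map \<phi> (tens m n) = tens (\<phi> m) n"
  using tens_map_proj[of "frag_of (m, n)"] by (simp add: tens_def)

end

end

section \<open>Words and enveloping superalgebras\<close>

lemma plus_list_eq: "(a :: 'a list) + b = a @ b"
  by (simp add: plus_list_def)

lemma zero_list_eq: "(0 :: 'a list) = []"
  by (simp add: zero_list_def)

lemma free_alg_simps [simp]:
  "p \<in> carrier (free_alg L) \<longleftrightarrow> Poly_Mapping.keys p \<subseteq> lists L"
  "p \<otimes>\<^bsub>free_alg L\<^esub> q = p * q" "p \<oplus>\<^bsub>free_alg L\<^esub> q = p + q"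
  "\<one>\<^bsub>free_alg L\<^esub> = 1" "\<zero>\<^bsub>free_alg L\<^esub> = 0"
  by (simp_all add: free_alg_def)

lemma keys_mult_lists:
  "\<lbrakk>Poly_Mapping.keys p \<subseteq> lists L; Poly_Mapping.keys q \<subseteq> lists L\<rbrakk> \<Longrightarrow> Poly_Mapping.keys (p * q) \<subseteq> lists L"
  using keys_mult[of p q] by (fastforce simp: plus_list_eq)

lemma keys_add_lists:
  "\<lbrakk>Poly_Mapping.keys p \<subseteq> S; Poly_Mapping.keys q \<subseteq> S\<rbrakk> \<Longrightarrow> Poly_Mapping.keys (p + q) \<subseteq> S"
  using keys_add[of p q] by blast

lemma keys_diff_lists:
  "\<lbrakk>Poly_Mapping.keys p \<subseteq> S; Poly_Mapping.keys q \<subseteq> S\<rbrakk> \<Longrightarrow> Poly_Mapping.keys (p - q) \<subseteq> S"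
  using keys_diff[of p q] by blast

lemma keys_letter: "x \<in> L \<Longrightarrow> Poly_Mapping.keys (letter x) \<subseteq> lists L"
  by (simp add: letter_def)

lemma keys_const: "Poly_Mapping.keys (const c) \<subseteq> lists L"
  by (simp add: const_def)

lemma keys_one_lists: "Poly_Mapping.keys (1 :: 'a list \<Rightarrow>\<^sub>0 complex) \<subseteq> lists L"
  by (simp add: zero_list_eq)

lemmas keys_lists = keys_mult_lists keys_add_lists keys_diff_lists keys_letter keys_const keys_one_lists

lemma ring_free_alg: "ring (free_alg L)"
proof (rule ringI)
  show "abelian_group (free_alg L)"
  proof (rule abelian_groupI)
    fix p assume "p \<in> carrier (free_alg L)"
    then show "\<exists>q\<in>carrier (free_alg L). q \<oplus>\<^bsub>free_alg L\<^esub> p = \<zero>\<^bsub>free_alg L\<^esub>"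
      by (intro bexI[of _ "- p"]) auto
  qed (simp_all add: keys_add_lists add.assoc add.commute)
  show "Group.monoid (free_alg L)"
    by (rule monoidI) (simp_all add: keys_mult_lists keys_one_lists mult.assoc del: keys_one)
qed (simp_all add: distrib_left distrib_right)

lemma ideal_free_algI:
  assumes sub: "\<And>p. p \<in> I \<Longrightarrow> Poly_Mapping.keys p \<subseteq> lists L" and z: "0 \<in> I"
    and diff: "\<And>p q. \<lbrakk>p \<in> I; q \<in> I\<rbrakk> \<Longrightarrow> p - q \<in> I"
    and l: "\<And>p q. \<lbrakk>p \<in> I; Poly_Mapping.keys q \<subseteq> lists L\<rbrakk> \<Longrightarrow> q * p \<in> I"
    and r: "\<And>p q. \<lbrakk>p \<in> I; Poly_Mapping.keys q \<subseteq> lists L\<rbrakk> \<Longrightarrow> p * q \<in> I"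
  shows "ideal I (free_alg L)"
proof (rule idealI[OF ring_free_alg])
  interpret ring "free_alg L" by (rule ring_free_alg)
  show "subgroup I (add_monoid (free_alg L))"
  proof (rule add.subgroupI)
    show "I \<subseteq> carrier (free_alg L)" using sub by auto
    show "I \<noteq> {}" using z by blast
    show "\<ominus>\<^bsub>free_alg L\<^esub> p \<in> I" if "p \<in> I" for p
    proof -
      have "\<ominus>\<^bsub>free_alg L\<^esub> p = - p"
        using sub[OF that] by (intro minus_equality) auto
      then show ?thesis using diff[OF z that] by simp
    qed
    show "p \<oplus>\<^bsub>free_alg L\<^esub> q \<in> I" if "p \<in> I" "q \<in> I" for p q
      using diff[OF that(1) diff[OF z that(2)]] by simp
  qed
qed (use l r in auto)

lemma ideal_free_algD:
  assumes "ideal I (free_alg L)"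
  shows "p \<in> I \<Longrightarrow> Poly_Mapping.keys p \<subseteq> lists L" and "0 \<in> I"
    and "\<lbrakk>p \<in> I; q \<in> I\<rbrakk> \<Longrightarrow> p - q \<in> I"
    and "\<lbrakk>p \<in> I; Poly_Mapping.keys q \<subseteq> lists L\<rbrakk> \<Longrightarrow> q * p \<in> I"
    and "\<lbrakk>p \<in> I; Poly_Mapping.keys q \<subseteq> lists L\<rbrakk> \<Longrightarrow> p * q \<in> I"
proof -
  note s = ideal.axioms(1)[OF assms]
  show sub: "Poly_Mapping.keys p \<subseteq> lists L" if "p \<in> I" for p
    using subsetD[OF additive_subgroup.a_subset[OF s] that] by (simp only: free_alg_simps)
  show "0 \<in> I" using additive_subgroup.zero_closed[OF s] by simp
  show "q * p \<in> I" if "p \<in> I" "Poly_Mapping.keys q \<subseteq> lists L"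
    using ideal.I_l_closed[OF assms that(1), of q] that(2) by simp
  show r: "p * q \<in> I" if "p \<in> I" "Poly_Mapping.keys q \<subseteq> lists L" for p q
    using ideal.I_r_closed[OF assms that(1), of q] that(2) by simp
  show "p - q \<in> I" if "p \<in> I" "q \<in> I"
  proof -
    have "q * (- 1) \<in> I" using that(2) by (rule r) (simp add: zero_list_eq)
    then show ?thesis using additive_subgroup.a_closed[OF s that(1), of "- q"] by simp
  qed
qed

lemma const_mult_single: "const c * Poly_Mapping.single w d = Poly_Mapping.single w (c * d)"
  by (simp add: const_def mult_single plus_list_eq)

lemma single_mult_const: "Poly_Mapping.single w d * const c = Poly_Mapping.single w (d * c)"
  by (simp add: const_def mult_single plus_list_eq)

lemma sum_single_keys:
  fixes p :: "'a \<Rightarrow>\<^sub>0 'b :: comm_monoid_add"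
  shows "p = (\<Sum>w\<in>Poly_Mapping.keys p. Poly_Mapping.single w (Poly_Mapping.lookup p w))"
proof (rule poly_mapping_eqI)
  fix w
  show "Poly_Mapping.lookup p w =
      Poly_Mapping.lookup (\<Sum>w\<in>Poly_Mapping.keys p. Poly_Mapping.single w (Poly_Mapping.lookup p w)) w"
    by (cases "w \<in> Poly_Mapping.keys p")
      (auto simp: lookup_sum lookup_single when_def in_keys_iff)
qed

lemma const_commute: "const c * p = p * const c"
proof -
  have "const c * (\<Sum>w\<in>S. Poly_Mapping.single w (f w)) = (\<Sum>w\<in>S. Poly_Mapping.single w (f w)) * const c"
    for f :: "'a list \<Rightarrow> complex" and S
    by (simp add: sum_distrib_left sum_distrib_right const_mult_single single_mult_const mult.commute)
  then show ?thesis using sum_single_keys[of p] by metis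
qed

lemma const_mult_const: "const c * const d = const (c * d)"
  by (simp add: const_def mult_single plus_list_eq)

lemma const_add: "const (c + d) = const c + const d"
  by (simp add: const_def single_add)

lemma const_1: "const 1 = 1"
  by (simp add: const_def zero_list_eq[symmetric])

lemma single_Cons: "Poly_Mapping.single (x # w) c = letter x * Poly_Mapping.single w c"
  by (simp add: letter_def mult_single plus_list_eq)

text \<open>The algebra homomorphism from the free algebra to \<open>\<complex>\<close> extending \<open>\<chi>\<close>; it induces the action
  of an enveloping algebra on the one-dimensional module of a character.\<close>

definition eval_word_sum :: "('a \<Rightarrow> complex) \<Rightarrow> ('a list \<Rightarrow>\<^sub>0 complex) \<Rightarrow> complex" where
  "eval_word_sum \<chi> p = (\<Sum>w\<in>Poly_Mapping.keys p. Poly_Mapping.lookup p w * prod_list (map \<chi> w))"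

lemma eval_single: "eval_word_sum \<chi> (Poly_Mapping.single w c) = c * prod_list (map \<chi> w)"
  by (simp add: eval_word_sum_def)

lemma eval_letter: "eval_word_sum \<chi> (letter x) = \<chi> x"
  by (simp add: letter_def eval_single)

lemma eval_const: "eval_word_sum \<chi> (const c) = c"
  by (simp add: const_def eval_single)

lemma eval_add: "eval_word_sum \<chi> (p + q) = eval_word_sum \<chi> p + eval_word_sum \<chi> q"
  unfolding eval_word_sum_def
  by (rule setsum_keys_plus_distrib) (simp_all add: algebra_simps)

lemma eval_0: "eval_word_sum \<chi> 0 = 0"
  by (simp add: eval_word_sum_def)

lemma eval_diff: "eval_word_sum \<chi> (p - q) = eval_word_sum \<chi> p - eval_word_sum \<chi> q"
  using eval_add[of \<chi> "p - q" q] by simp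

lemma eval_sum: "eval_word_sum \<chi> (\<Sum>i\<in>I. f i) = (\<Sum>i\<in>I. eval_word_sum \<chi> (f i))"
  by (induction I rule: infinite_finite_induct) (simp_all add: eval_0 eval_add)

lemma eval_mult: "eval_word_sum \<chi> (p * q) = eval_word_sum \<chi> p * eval_word_sum \<chi> q"
proof -
  let ?s = "\<lambda>p w. Poly_Mapping.single w (Poly_Mapping.lookup p w) :: 'a list \<Rightarrow>\<^sub>0 complex"
  have "p * q = (\<Sum>a\<in>Poly_Mapping.keys p. ?s p a) * (\<Sum>b\<in>Poly_Mapping.keys q. ?s q b)"
    using sum_single_keys[of p] sum_single_keys[of q] by simp
  then have "eval_word_sum \<chi> (p * q) =
      (\<Sum>a\<in>Poly_Mapping.keys p. \<Sum>b\<in>Poly_Mapping.keys q. eval_word_sum \<chi> (?s p a * ?s q b))"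
    by (simp only: sum_product eval_sum)
  also have "\<dots> = eval_word_sum \<chi> p * eval_word_sum \<chi> q"
    by (simp add: mult_single eval_single plus_list_eq)
      (simp add: eval_word_sum_def sum_product algebra_simps)
  finally show ?thesis .
qed

context lie_superalgebra
begin

lemma uea_rels_carrier: "uea_rels g \<subseteq> carrier (free_alg (lspace g))"
proof -
  have "x + y \<in> lspace g" if "x \<in> lspace g" "y \<in> lspace g" for x y
    using that by (rule L.subspace_add[OF subspace_lspace])
  moreover have "smul g c x \<in> lspace g" if "x \<in> lspace g" for c x
    using that by (rule L.subspace_scale[OF subspace_lspace])
  ultimately show ?thesis
    unfolding uea_rels_def
    by (intro Un_least subsetI; clarify; simp only: free_alg_simps; intro keys_lists)
      (auto intro: br_lspace part_lspace)
qed

lemma uea_rels_poly_in: "t \<in> uea_rels g \<Longrightarrow> Poly_Mapping.keys t \<subseteq> lists (lspace g)"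
  using subsetD[OF uea_rels_carrier] by (simp only: free_alg_simps)

lemma ideal_uea_ideal: "ideal (uea_ideal g) (free_alg (lspace g))"
  unfolding uea_ideal_def by (rule ring.genideal_ideal[OF ring_free_alg uea_rels_carrier])

lemma uea_rels_in_ideal: "t \<in> uea_rels g \<Longrightarrow> t \<in> uea_ideal g"
  unfolding uea_ideal_def using ring.genideal_self[OF ring_free_alg uea_rels_carrier] by blast

lemma ring_UEA: "ring (UEA g)"
  unfolding UEA_def by (rule ideal.quotient_is_ring[OF ideal_uea_ideal])

lemma uea_class_hom: "uea_class g \<in> ring_hom (free_alg (lspace g)) (UEA g)"
proof -
  have "uea_class g = (+>\<^bsub>free_alg (lspace g)\<^esub>) (uea_ideal g)"
    by (rule ext) (simp add: uea_class_def)
  then show ?thesis using ideal.rcos_ring_hom[OF ideal_uea_ideal] unfolding UEA_def by simp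
qed

abbreviation poly_in :: "('a list \<Rightarrow>\<^sub>0 complex) \<Rightarrow> bool" where
  "poly_in p \<equiv> Poly_Mapping.keys p \<subseteq> lists (lspace g)"

lemma uea_class_closed: "poly_in p \<Longrightarrow> uea_class g p \<in> carrier (UEA g)"
  using ring_hom_closed[OF uea_class_hom, of p] by simp

lemma uea_class_mult:
  "\<lbrakk>poly_in p; poly_in q\<rbrakk> \<Longrightarrow> uea_class g (p * q) = uea_class g p \<otimes>\<^bsub>UEA g\<^esub> uea_class g q"
  using ring_hom_mult[OF uea_class_hom, of p q] by simp

lemma uea_class_add:
  "\<lbrakk>poly_in p; poly_in q\<rbrakk> \<Longrightarrow> uea_class g (p + q) = uea_class g p \<oplus>\<^bsub>UEA g\<^esub> uea_class g q"
  using ring_hom_add[OF uea_class_hom, of p q] by simp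

lemma uea_carrierE:
  assumes "a \<in> carrier (UEA g)"
  obtains p where "poly_in p" "a = uea_class g p"
proof -
  have "\<exists>p\<in>carrier (free_alg (lspace g)). a = uea_ideal g +>\<^bsub>free_alg (lspace g)\<^esub> p"
    using assms unfolding UEA_def FactRing_def A_RCOSETS_def' by simp
  then show thesis using that by (auto simp: uea_class_def)
qed

lemma parity_words_lists: "parity_words g i \<subseteq> lists (lspace g)"
proof -
  have "set w \<subseteq> lspace g" if "list_all2 (\<lambda>x p. x \<in> part g p) w ps" for w ps
    using that by (induction rule: list_all2_induct) (auto intro: part_lspace)
  then show ?thesis unfolding parity_words_def by blast
qed

lemma uea_class_eqI:
  assumes p: "poly_in p" and q: "poly_in q" and d: "p - q \<in> uea_ideal g"
  shows "uea_class g p = uea_class g q"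
proof -
  interpret I: ideal "uea_ideal g" "free_alg (lspace g)" by (rule ideal_uea_ideal)
  have "p \<in> uea_ideal g +>\<^bsub>free_alg (lspace g)\<^esub> q"
    unfolding a_r_coset_def' using d by (auto intro!: bexI[of _ "p - q"])
  then show ?thesis
    unfolding uea_class_def using I.a_repr_independence'[of p q] q by simp
qed

lemma mem_uea_class_iff: "t \<in> uea_class g p \<longleftrightarrow> (\<exists>k\<in>uea_ideal g. t = k + p)"
  unfolding uea_class_def a_r_coset_def' by auto

lemma uea_class_letter_add:
  assumes "x \<in> lspace g" "y \<in> lspace g"
  shows "uea_class g (letter (x + y)) = uea_class g (letter x + letter y)"
proof (rule uea_class_eqI)
  have "letter (x + y) - letter x - letter y \<in> uea_rels g"
    using assms unfolding uea_rels_def by blast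
  then show "letter (x + y) - (letter x + letter y) \<in> uea_ideal g"
    using uea_rels_in_ideal by (simp add: diff_diff_eq)
qed (intro keys_lists assms L.subspace_add[OF subspace_lspace])+

lemma uea_class_letter_swap:
  assumes "x \<in> part g i" "y \<in> part g j"
  shows "uea_class g (letter x * letter y) =
    uea_class g (const (ksign i j) * letter y * letter x + letter (br g x y))"
proof (rule uea_class_eqI)
  have "letter x * letter y - const (ksign i j) * letter y * letter x - letter (br g x y) \<in> uea_rels g"
    using assms unfolding uea_rels_def by blast
  then show "letter x * letter y - (const (ksign i j) * letter y * letter x + letter (br g x y)) \<in> uea_ideal g"
    using uea_rels_in_ideal by (simp add: diff_diff_eq)
qed (intro keys_lists br_lspace part_lspace[OF assms(1)] part_lspace[OF assms(2)])+

end

section \<open>The module \<open>Q\<^sub>\<chi>\<close> of a character of a subalgebra\<close>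

lemma complex_ring_simps [simp]:
  "carrier complex_ring = UNIV" "x \<oplus>\<^bsub>complex_ring\<^esub> y = x + y" "\<zero>\<^bsub>complex_ring\<^esub> = 0"
  by (simp_all add: complex_ring_def)

lemma abelian_group_complex_ring: "abelian_group complex_ring"
proof (rule abelian_groupI)
  fix x assume "x \<in> carrier complex_ring"
  show "\<exists>y\<in>carrier complex_ring. y \<oplus>\<^bsub>complex_ring\<^esub> x = \<zero>\<^bsub>complex_ring\<^esub>"
    by (intro bexI[of _ "- x"]) simp_all
qed (simp_all add: add.assoc add.commute)

text \<open>A graded subalgebra \<open>M\<close> and an even linear functional \<open>\<chi>\<close> on \<open>g\<close> whose restriction to \<open>M\<close> is a
  character.\<close>

locale subalgebra_character = lie_superalgebra g
  for g :: "('a :: ab_group_add) lie_super" +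
  fixes M :: "'a set" and \<chi> :: "'a \<Rightarrow> complex"
  assumes M_subspace: "L.subspace M"
    and M_br: "\<lbrakk>x \<in> part g i \<inter> M; y \<in> part g j \<inter> M\<rbrakk> \<Longrightarrow> br g x y \<in> M"
    and \<chi>_add: "\<lbrakk>x \<in> lspace g; y \<in> lspace g\<rbrakk> \<Longrightarrow> \<chi> (x + y) = \<chi> x + \<chi> y"
    and \<chi>_smul: "x \<in> lspace g \<Longrightarrow> \<chi> (smul g c x) = c * \<chi> x"
    and \<chi>_odd: "x \<in> part g 1 \<Longrightarrow> \<chi> x = 0"
    and \<chi>_br: "\<lbrakk>x \<in> part g i \<inter> M; y \<in> part g j \<inter> M\<rbrakk> \<Longrightarrow> \<chi> (br g x y) = 0"
begin

lemma restr_simps [simp]: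
  "part (restr g M) i = part g i \<inter> M" "smul (restr g M) = smul g" "br (restr g M) = br g"
  by (simp_all add: restr_def)

lemma lspace_restr: "lspace (restr g M) \<subseteq> lspace g"
  unfolding lspace_def by auto

lemma lie_superalgebra_restr: "lie_superalgebra (restr g M)"
proof (rule lie_superalgebra.intro)
  show "part (restr g M) 0 \<inter> part (restr g M) 1 = {0}"
    using part_disjoint L.subspace_0[OF M_subspace] by auto
  show "module.subspace (smul (restr g M)) (part (restr g M) i)" for i
    using L.subspace_inter[OF part_subspace M_subspace] by simp
  show "vector_space (smul (restr g M))" using vs by simp
next
  fix x y i j assume "x \<in> part (restr g M) i" "y \<in> part (restr g M) j"
  then show "br (restr g M) x y \<in> part (restr g M) (i + j)"
    using br_part[of x i y j] M_br[of x i y j] by auto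
next
  fix x y i j assume "x \<in> part (restr g M) i" "y \<in> part (restr g M) j"
  then show "br (restr g M) x y = - smul (restr g M) (ksign i j) (br (restr g M) y x)"
    using br_skew[of x i y j] by simp
next
  fix x y z i j k
  assume "x \<in> part (restr g M) i" "y \<in> part (restr g M) j" "z \<in> part (restr g M) k"
  then show "br (restr g M) x (br (restr g M) y z) = br (restr g M) (br (restr g M) x y) z
      + smul (restr g M) (ksign i j) (br (restr g M) y (br (restr g M) x z))"
    using jacobi[of x i y j z k] by simp
qed (use lspace_restr in \<open>simp_all add: br_add_left br_add_right br_smul_left br_smul_right subset_iff\<close>)

sublocale N: lie_superalgebra "restr g M" by (rule lie_superalgebra_restr)

lemma uea_rels_restr: "uea_rels (restr g M) \<subseteq> uea_rels g"
  unfolding uea_rels_def using lspace_restr by (intro Un_mono subsetI) (auto, blast+)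

lemma N_poly_in: "N.poly_in p \<Longrightarrow> poly_in p"
  using lspace_restr lists_mono by blast

text \<open>The defining ideal of \<open>U(g)\<close> meets the free algebra on the letters from \<open>M\<close> in an ideal that
  contains the relations of \<open>U(M)\<close>; this makes \<open>U(M) \<rightarrow> U(g)\<close> well defined.\<close>

lemma uea_ideal_restr: "uea_ideal (restr g M) \<subseteq> uea_ideal g"
proof -
  note I = ideal_free_algD[OF ideal_uea_ideal]
  define J where "J = {p \<in> uea_ideal g. N.poly_in p}"
  have "ideal J (free_alg (lspace (restr g M)))"
    by (rule ideal_free_algI)
      (use I N_poly_in in \<open>simp_all add: J_def keys_diff_lists keys_mult_lists\<close>)
  moreover have "uea_rels (restr g M) \<subseteq> J"
    using uea_rels_restr uea_rels_in_ideal N.uea_rels_poly_in unfolding J_def by blast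
  ultimately have "uea_ideal (restr g M) \<subseteq> J"
    unfolding uea_ideal_def by (rule ring.genideal_minimal[OF ring_free_alg])
  then show ?thesis by (auto simp: J_def)
qed

lemma uea_incl_class:
  assumes "N.poly_in p"
  shows "uea_incl g (uea_class (restr g M) p) = uea_class g p"
proof -
  have "uea_class g t = uea_class g p" if t: "t \<in> uea_class (restr g M) p" for t
  proof -
    obtain k where k: "k \<in> uea_ideal (restr g M)" "t = k + p"
      using t by (auto simp: N.mem_uea_class_iff)
    have "N.poly_in k"
      using ideal_free_algD(1)[OF N.ideal_uea_ideal k(1)] .
    then have "N.poly_in t" using k assms keys_add_lists by metis
    then show ?thesis
      using assms k uea_ideal_restr by (intro uea_class_eqI N_poly_in) auto
  qed
  moreover have "p \<in> uea_class (restr g M) p"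
    using ideal_free_algD(2)[OF N.ideal_uea_ideal]
    by (auto simp: N.mem_uea_class_iff intro!: bexI[of _ 0])
  ultimately have "uea_class g ` uea_class (restr g M) p = {uea_class g p}" by blast
  then show ?thesis by (simp add: uea_incl_def)
qed

text \<open>The relation \<open>xy - (-1)\<^bsup>|x||y|\<^esup>yx = [x, y]\<close> evaluates to \<open>0 = 0\<close>: the left side could only
  survive for odd \<open>x\<close> and \<open>y\<close>, where \<open>\<chi>\<close> vanishes, and the right side is \<open>\<chi>([x, y]) = 0\<close>.\<close>

lemma eval_uea_ideal:
  assumes "k \<in> uea_ideal (restr g M)" shows "eval_word_sum \<chi> k = 0"
proof -
  define J where "J = {p. N.poly_in p \<and> eval_word_sum \<chi> p = 0}"
  have "ideal J (free_alg (lspace (restr g M)))"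
    by (rule ideal_free_algI)
      (simp_all add: J_def eval_0 eval_diff eval_mult keys_diff_lists keys_mult_lists)
  moreover have "uea_rels (restr g M) \<subseteq> J"
  proof
    fix t assume t: "t \<in> uea_rels (restr g M)"
    then consider
        (add) x y where "x \<in> lspace (restr g M)" "y \<in> lspace (restr g M)" "t = letter (x + y) - letter x - letter y"
      | (smul) c x where "x \<in> lspace (restr g M)" "t = letter (smul g c x) - const c * letter x"
      | (br) x y i j where "x \<in> part g i \<inter> M" "y \<in> part g j \<inter> M"
          "t = letter x * letter y - const (ksign i j) * letter y * letter x - letter (br g x y)"
      unfolding uea_rels_def by auto
    then have "eval_word_sum \<chi> t = 0"
    proof cases
      case add
      then have "x \<in> lspace g" "y \<in> lspace g" using lspace_restr by auto
      then show ?thesis unfolding add(3) by (simp add: eval_diff eval_letter \<chi>_add)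
    next
      case smul
      then have "x \<in> lspace g" using lspace_restr by auto
      then show ?thesis
        unfolding smul(2) by (simp add: eval_diff eval_letter eval_mult eval_const \<chi>_smul)
    next
      case br
      have k: "ksign i j * (\<chi> y * \<chi> x) = \<chi> x * \<chi> y"
        using br(1,2) \<chi>_odd[of x] by (auto simp: ksign_def)
      show ?thesis
        unfolding br(3)
        by (simp only: eval_diff eval_letter eval_mult eval_const mult.assoc k \<chi>_br[OF br(1,2)]
            diff_self diff_zero)
    qed
    then show "t \<in> J" using N.uea_rels_poly_in[OF t] unfolding J_def by blast
  qed
  ultimately have "uea_ideal (restr g M) \<subseteq> J"
    unfolding uea_ideal_def by (rule ring.genideal_minimal[OF ring_free_alg])
  then show ?thesis using assms by (auto simp: J_def)
qed

lemma uea_char_class: "uea_char \<chi> (uea_class (restr g M) p) = eval_word_sum \<chi> p"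
proof -
  have "eval_word_sum \<chi> t = eval_word_sum \<chi> p" if "t \<in> uea_class (restr g M) p" for t
    using that eval_uea_ideal by (auto simp: N.mem_uea_class_iff eval_add)
  moreover have "p \<in> uea_class (restr g M) p"
    using ideal_free_algD(2)[OF N.ideal_uea_ideal]
    by (auto simp: N.mem_uea_class_iff intro!: bexI[of _ 0])
  ultimately have "eval_word_sum \<chi> ` uea_class (restr g M) p = {eval_word_sum \<chi> p}" by blast
  then show ?thesis by (simp add: uea_char_def eval_word_sum_def[abs_def])
qed

sublocale U: ring "UEA g" by (rule ring_UEA)

lemma uea_incl_closed:
  assumes "y \<in> carrier (UEA (restr g M))" shows "uea_incl g y \<in> carrier (UEA g)"
proof -
  obtain p where "N.poly_in p" "y = uea_class (restr g M) p" using assms by (rule N.uea_carrierE)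
  then show ?thesis by (simp add: uea_incl_class uea_class_closed N_poly_in)
qed

sublocale T: tensor_factors "carrier (UEA (restr g M))" "UEA g" complex_ring
  "\<lambda>a y. a \<otimes>\<^bsub>UEA g\<^esub> uea_incl g y" "\<lambda>y c. uea_char \<chi> y * c"
  by (rule tensor_factors.intro)
    (simp_all add: uea_incl_closed U.abelian_group_axioms abelian_group_complex_ring)

lemma Q_eq: "Q g \<chi> M = T.tensor"
  by (simp add: Q_def)

lemma Q_class_eq: "Q_class g \<chi> M t = T.rels #>\<^bsub>T.pairs\<^esub> t"
  by (simp add: Q_class_def Q_rels_def)

lemma Q_act_eq: "Q_act g \<chi> M a = T.tens_map (\<lambda>b. a \<otimes>\<^bsub>UEA g\<^esub> b)"
  by (rule ext) (simp add: Q_act_def T.tens_map_def Q_class_eq)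

text \<open>The defining property of \<open>Q\<^sub>\<chi>\<close> in terms of words: elements of \<open>U(M)\<close> cross the tensor sign and
  become scalars.\<close>

lemma tens_move:
  assumes "a \<in> carrier (UEA g)" "N.poly_in p"
  shows "T.tens (a \<otimes>\<^bsub>UEA g\<^esub> uea_class g p) c = T.tens a (eval_word_sum \<chi> p * c)"
  using T.tens_balanced[OF assms(1) N.uea_class_closed[OF assms(2)], of c] assms(2)
  by (simp add: uea_incl_class uea_char_class)

lemma Q_act_tens:
  "\<lbrakk>a \<in> carrier (UEA g); b \<in> carrier (UEA g)\<rbrakk> \<Longrightarrow>
     Q_act g \<chi> M a (T.tens b c) = T.tens (a \<otimes>\<^bsub>UEA g\<^esub> b) c"
  and Q_act_hom: "a \<in> carrier (UEA g) \<Longrightarrow> Q_act g \<chi> M a \<in> hom T.tensor T.tensor"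
proof -
  have bal: "T.tens (a \<otimes>\<^bsub>UEA g\<^esub> (m \<otimes>\<^bsub>UEA g\<^esub> uea_incl g y)) n = T.tens (a \<otimes>\<^bsub>UEA g\<^esub> m) (uea_char \<chi> y * n)"
    if "a \<in> carrier (UEA g)" "m \<in> carrier (UEA g)" "y \<in> carrier (UEA (restr g M))" for a m y n
    using that T.tens_balanced[of "a \<otimes>\<^bsub>UEA g\<^esub> m" y n] uea_incl_closed by (simp add: U.m_assoc)
  show "Q_act g \<chi> M a (T.tens b c) = T.tens (a \<otimes>\<^bsub>UEA g\<^esub> b) c"
    if "a \<in> carrier (UEA g)" "b \<in> carrier (UEA g)"
    unfolding Q_act_eq using that
    by (subst T.tens_map_tens) (simp_all add: bal U.r_distr)
  show "Q_act g \<chi> M a \<in> hom T.tensor T.tensor" if "a \<in> carrier (UEA g)"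
    unfolding Q_act_eq using that by (intro T.tens_map_hom) (simp_all add: bal U.r_distr)
qed

lemma uea_class_const_commute:
  assumes "b \<in> carrier (UEA g)"
  shows "uea_class g (const c) \<otimes>\<^bsub>UEA g\<^esub> b = b \<otimes>\<^bsub>UEA g\<^esub> uea_class g (const c)"
proof -
  obtain p where p: "poly_in p" "b = uea_class g p" using assms by (rule uea_carrierE)
  show ?thesis
    unfolding p(2) using const_commute[of c p]
      uea_class_mult[OF p(1) keys_const, of c] uea_class_mult[OF keys_const p(1), of c] by simp
qed

lemma Q_smul_tens:
  assumes "b \<in> carrier (UEA g)"
  shows "Q_smul g \<chi> M c (T.tens b d) = T.tens b (c * d)"
  unfolding Q_smul_def using assms
  by (simp add: Q_act_tens uea_class_closed keys_const uea_class_const_commute tens_move eval_const)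

lemma Q_smul_hom: "Q_smul g \<chi> M c \<in> hom T.tensor T.tensor"
  unfolding Q_smul_def by (intro Q_act_hom uea_class_closed keys_const)

lemma uea_part_closed: "a \<in> uea_part g i \<Longrightarrow> a \<in> carrier (UEA g)"
  unfolding uea_part_def using uea_class_closed parity_words_lists by blast

lemma Q_part_eq: "Q_part g \<chi> M i = generate T.tensor {T.tens a c | a c. a \<in> uea_part g i}"
  unfolding Q_part_def by (simp add: Q_eq Q_class_eq T.tens_def)

lemma W_one_closed: "\<one>\<^bsub>W_superalgebra g \<chi> M\<^esub> \<in> carrier (W_superalgebra g \<chi> M)"
proof -
  have "Q_act g \<chi> M a q \<in> carrier T.tensor" if "a \<in> carrier (UEA g)" "q \<in> carrier T.tensor" for a q
    using hom_in_carrier[OF Q_act_hom[OF that(1)] that(2)] .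
  moreover have "Q_smul g \<chi> M c q \<in> carrier T.tensor" if "q \<in> carrier T.tensor" for c q
    using hom_in_carrier[OF Q_smul_hom that] .
  moreover have "(\<lambda>q\<in>carrier T.tensor. q) \<in> hom T.tensor T.tensor"
    using monoid.m_closed[OF group.is_monoid[OF T.group_tensor]] by (intro homI) simp_all
  ultimately show ?thesis
    unfolding W_superalgebra_def End_Q_def Q_eq by (simp add: uea_class_closed keys_letter)
qed

end

section \<open>Right multiplication by an odd normalising element\<close>

text \<open>An odd \<open>v\<close> with \<open>[M, v] \<subseteq> M\<close> and \<open>\<chi>([M, v]) = 0\<close>.  These are the conditions under which \<open>v\<close> sends
  the generator of \<open>Q\<^sub>\<chi>\<close> to a vector on which \<open>M\<close> still acts through \<open>\<chi>\<close>.\<close>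

locale odd_normaliser = subalgebra_character +
  fixes v
  assumes v_odd: "v \<in> part g 1"
    and v_br: "x \<in> part g i \<inter> M \<Longrightarrow> br g x v \<in> M"
    and \<chi>_v: "x \<in> part g i \<inter> M \<Longrightarrow> \<chi> (br g x v) = 0"
begin

abbreviation cls where "cls \<equiv> uea_class g"

definition v_class where "v_class = cls (letter v)"

lemma v_poly: "poly_in (letter v)"
  by (intro keys_letter part_lspace[OF v_odd])

lemma v_class_closed: "v_class \<in> carrier (UEA g)"
  unfolding v_class_def by (rule uea_class_closed[OF v_poly])

lemma N_letter: "x \<in> part g i \<inter> M \<Longrightarrow> N.poly_in (letter x)"
  by (intro keys_letter N.part_lspace[of _ i]) simp

text \<open>Here \<open>xv = \<plusminus>vx + [x, v]\<close>.  The sign is harmless, because it is negative only for odd \<open>x\<close>, where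
  \<open>\<chi> x = 0\<close>; the bracket crosses the tensor sign and dies, because \<open>\<chi>([x, v]) = 0\<close>.\<close>

lemma tens_homogeneous_letter:
  assumes b: "b \<in> carrier (UEA g)" and x: "x \<in> part g i \<inter> M"
  shows "T.tens (b \<otimes>\<^bsub>UEA g\<^esub> cls (letter x) \<otimes>\<^bsub>UEA g\<^esub> v_class) c = T.tens (b \<otimes>\<^bsub>UEA g\<^esub> v_class) (\<chi> x * c)"
proof -
  have lx: "N.poly_in (letter x)" using N_letter[OF x] .
  have xv: "br g x v \<in> part g (i + 1) \<inter> M" using br_part[of x i v 1] v_odd v_br x by auto
  let ?k = "const (ksign i 1) :: 'a list \<Rightarrow>\<^sub>0 complex"
  have kx: "N.poly_in (?k * letter x)" by (intro keys_mult_lists keys_const lx)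
  have "letter v * (?k * letter x) = ?k * letter v * letter x"
    by (metis const_commute mult.assoc)
  then have "cls (letter x) \<otimes>\<^bsub>UEA g\<^esub> v_class = cls (letter v * (?k * letter x) + letter (br g x v))"
    using uea_class_letter_swap[of x i v 1] x v_odd uea_class_mult[OF N_poly_in[OF lx] v_poly]
    by (simp add: v_class_def)
  also have "\<dots> = v_class \<otimes>\<^bsub>UEA g\<^esub> cls (?k * letter x) \<oplus>\<^bsub>UEA g\<^esub> cls (letter (br g x v))"
    using N_poly_in[OF kx] v_poly N_poly_in[OF N_letter[OF xv]]
    by (simp add: v_class_def uea_class_add uea_class_mult keys_mult_lists)
  finally have "b \<otimes>\<^bsub>UEA g\<^esub> cls (letter x) \<otimes>\<^bsub>UEA g\<^esub> v_class =
      b \<otimes>\<^bsub>UEA g\<^esub> v_class \<otimes>\<^bsub>UEA g\<^esub> cls (?k * letter x) \<oplus>\<^bsub>UEA g\<^esub> b \<otimes>\<^bsub>UEA g\<^esub> cls (letter (br g x v))"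
    using b v_class_closed uea_class_closed[OF N_poly_in[OF kx]] uea_class_closed[OF N_poly_in[OF lx]]
      uea_class_closed[OF N_poly_in[OF N_letter[OF xv]]]
    by (simp add: U.m_assoc U.r_distr)
  then have "T.tens (b \<otimes>\<^bsub>UEA g\<^esub> cls (letter x) \<otimes>\<^bsub>UEA g\<^esub> v_class) c =
      T.tens (b \<otimes>\<^bsub>UEA g\<^esub> v_class) (eval_word_sum \<chi> (?k * letter x) * c)
      \<otimes>\<^bsub>T.tensor\<^esub> T.tens b (eval_word_sum \<chi> (letter (br g x v)) * c)"
    using b v_class_closed uea_class_closed[OF N_poly_in[OF kx]] uea_class_closed[OF N_poly_in[OF N_letter[OF xv]]]
    by (simp add: T.tens_add_left tens_move[OF _ kx] tens_move[OF _ N_letter[OF xv]])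
  moreover have "eval_word_sum \<chi> (?k * letter x) = \<chi> x"
    using \<chi>_odd[of x] x by (auto simp: eval_mult eval_const eval_letter ksign_def)
  moreover have "T.tens b (eval_word_sum \<chi> (letter (br g x v)) * c) = \<one>\<^bsub>T.tensor\<^esub>"
    using \<chi>_v[OF x] T.tens_zero_right[OF b] by (simp add: eval_letter)
  moreover have "T.tens (b \<otimes>\<^bsub>UEA g\<^esub> v_class) (\<chi> x * c) \<in> carrier T.tensor"
    using b v_class_closed by (intro T.tens_closed) simp_all
  ultimately show ?thesis
    using monoid.r_one[OF group.is_monoid[OF T.group_tensor]] by simp
qed

lemma tens_letter:
  assumes b: "b \<in> carrier (UEA g)" and x: "x \<in> lspace (restr g M)"
  shows "T.tens (b \<otimes>\<^bsub>UEA g\<^esub> cls (letter x) \<otimes>\<^bsub>UEA g\<^esub> v_class) c = T.tens (b \<otimes>\<^bsub>UEA g\<^esub> v_class) (\<chi> x * c)"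
proof -
  obtain x0 x1 where x01: "x = x0 + x1" "x0 \<in> part g 0 \<inter> M" "x1 \<in> part g 1 \<inter> M"
    using N.lspaceE[OF x] by auto
  have l: "x0 \<in> lspace g" "x1 \<in> lspace g" using x01 part_lspace by auto
  have c: "cls (letter x0) \<in> carrier (UEA g)" "cls (letter x1) \<in> carrier (UEA g)"
    using l by (auto intro!: uea_class_closed keys_letter)
  have "cls (letter x) = cls (letter x0) \<oplus>\<^bsub>UEA g\<^esub> cls (letter x1)"
    unfolding x01(1) uea_class_letter_add[OF l] using l by (intro uea_class_add keys_letter)
  then have "b \<otimes>\<^bsub>UEA g\<^esub> cls (letter x) \<otimes>\<^bsub>UEA g\<^esub> v_class =
     b \<otimes>\<^bsub>UEA g\<^esub> cls (letter x0) \<otimes>\<^bsub>UEA g\<^esub> v_class \<oplus>\<^bsub>UEA g\<^esub> b \<otimes>\<^bsub>UEA g\<^esub> cls (letter x1) \<otimes>\<^bsub>UEA g\<^esub> v_class"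
    using b c v_class_closed by (simp add: U.r_distr U.l_distr)
  then have "T.tens (b \<otimes>\<^bsub>UEA g\<^esub> cls (letter x) \<otimes>\<^bsub>UEA g\<^esub> v_class) c =
      T.tens (b \<otimes>\<^bsub>UEA g\<^esub> v_class) (\<chi> x0 * c) \<otimes>\<^bsub>T.tensor\<^esub> T.tens (b \<otimes>\<^bsub>UEA g\<^esub> v_class) (\<chi> x1 * c)"
    using b c v_class_closed tens_homogeneous_letter[OF b x01(2)] tens_homogeneous_letter[OF b x01(3)]
    by (simp add: T.tens_add_left)
  also have "\<dots> = T.tens (b \<otimes>\<^bsub>UEA g\<^esub> v_class) (\<chi> x0 * c + \<chi> x1 * c)"
    using T.tens_add_right[of "b \<otimes>\<^bsub>UEA g\<^esub> v_class" "\<chi> x0 * c" "\<chi> x1 * c"] b v_class_closed by simp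
  finally show ?thesis using l by (simp add: x01(1) \<chi>_add distrib_right)
qed

text \<open>Induction on the word, peeling letters from the left: the induction hypothesis moves \<open>v\<close> past
  the tail with \<open>bx\<close> in place of \<open>b\<close>, and a single letter remains.\<close>

lemma tens_single:
  assumes "b \<in> carrier (UEA g)" "w \<in> lists (lspace (restr g M))"
  shows "T.tens (b \<otimes>\<^bsub>UEA g\<^esub> cls (Poly_Mapping.single w d) \<otimes>\<^bsub>UEA g\<^esub> v_class) c =
    T.tens (b \<otimes>\<^bsub>UEA g\<^esub> v_class) (eval_word_sum \<chi> (Poly_Mapping.single w d) * c)"
  using assms(2,1)
proof (induction arbitrary: b rule: lists.induct)
  case Nil
  have k: "N.poly_in (const d)" by (rule keys_const)
  have "cls (const d) \<otimes>\<^bsub>UEA g\<^esub> v_class = v_class \<otimes>\<^bsub>UEA g\<^esub> cls (const d)"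
    using uea_class_mult[OF v_poly keys_const, of d] uea_class_mult[OF keys_const v_poly, of d]
      const_commute[of d "letter v"] by (simp add: v_class_def)
  then have "b \<otimes>\<^bsub>UEA g\<^esub> cls (const d) \<otimes>\<^bsub>UEA g\<^esub> v_class = b \<otimes>\<^bsub>UEA g\<^esub> v_class \<otimes>\<^bsub>UEA g\<^esub> cls (const d)"
    using Nil v_class_closed uea_class_closed[OF N_poly_in[OF k]] by (simp add: U.m_assoc)
  then show ?case
    using tens_move[OF _ k, of "b \<otimes>\<^bsub>UEA g\<^esub> v_class" c] Nil v_class_closed by (simp add: const_def)
next
  case (Cons x w)
  let ?s = "Poly_Mapping.single w d"
  have x: "poly_in (letter x)" and s: "poly_in ?s"
    using Cons.hyps lspace_restr by (auto intro!: keys_letter N_poly_in)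
  have bx: "b \<otimes>\<^bsub>UEA g\<^esub> cls (letter x) \<in> carrier (UEA g)"
    using Cons.prems uea_class_closed[OF x] by simp
  have "T.tens (b \<otimes>\<^bsub>UEA g\<^esub> cls (letter x) \<otimes>\<^bsub>UEA g\<^esub> cls ?s \<otimes>\<^bsub>UEA g\<^esub> v_class) c =
      T.tens (b \<otimes>\<^bsub>UEA g\<^esub> cls (letter x) \<otimes>\<^bsub>UEA g\<^esub> v_class) (eval_word_sum \<chi> ?s * c)"
    by (rule Cons.IH[OF bx])
  also have "\<dots> = T.tens (b \<otimes>\<^bsub>UEA g\<^esub> v_class) (\<chi> x * (eval_word_sum \<chi> ?s * c))"
    by (rule tens_letter[OF Cons.prems Cons.hyps(1)])
  finally show ?case
    using Cons.prems uea_class_closed[OF x] uea_class_closed[OF s]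
    by (simp add: single_Cons uea_class_mult[OF x s] eval_mult eval_letter U.m_assoc mult.assoc)
qed

text \<open>Compatibility of right multiplication by \<open>v\<close> with the action of \<open>U(M)\<close>, hence its
  well-definedness on \<open>Q\<^sub>\<chi>\<close>.\<close>

lemma tens_right_mult:
  assumes b: "b \<in> carrier (UEA g)" and p: "N.poly_in p"
  shows "T.tens (b \<otimes>\<^bsub>UEA g\<^esub> cls p \<otimes>\<^bsub>UEA g\<^esub> v_class) c = T.tens (b \<otimes>\<^bsub>UEA g\<^esub> v_class) (eval_word_sum \<chi> p * c)"
proof -
  let ?s = "\<lambda>w. Poly_Mapping.single w (Poly_Mapping.lookup p w)"
  have "poly_in (\<Sum>w\<in>S. ?s w) \<and>
      T.tens (b \<otimes>\<^bsub>UEA g\<^esub> cls (\<Sum>w\<in>S. ?s w) \<otimes>\<^bsub>UEA g\<^esub> v_class) c =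
      T.tens (b \<otimes>\<^bsub>UEA g\<^esub> v_class) (eval_word_sum \<chi> (\<Sum>w\<in>S. ?s w) * c)"
    if "S \<subseteq> Poly_Mapping.keys p" for S
    using finite_subset[OF that finite_keys] that
  proof (induction S rule: finite_induct)
    case empty
    \<comment> \<open>The zero polynomial is \<open>0\<close> times the empty word.\<close>
    then show ?case using tens_single[OF b, of "[]" 0 c] by simp
  next
    case (insert w S)
    let ?r = "\<Sum>w\<in>S. ?s w"
    have w: "w \<in> lists (lspace (restr g M))" using insert.prems p by blast
    then have s: "poly_in (?s w)" by (intro N_poly_in) simp
    have r: "poly_in ?r" using insert by simp
    have c: "cls (?s w) \<in> carrier (UEA g)" "cls ?r \<in> carrier (UEA g)"
      using s r uea_class_closed by blast+
    have "b \<otimes>\<^bsub>UEA g\<^esub> cls (?s w + ?r) \<otimes>\<^bsub>UEA g\<^esub> v_class =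
       b \<otimes>\<^bsub>UEA g\<^esub> cls (?s w) \<otimes>\<^bsub>UEA g\<^esub> v_class \<oplus>\<^bsub>UEA g\<^esub> b \<otimes>\<^bsub>UEA g\<^esub> cls ?r \<otimes>\<^bsub>UEA g\<^esub> v_class"
      using b c v_class_closed by (simp add: uea_class_add[OF s r] U.r_distr U.l_distr)
    then have "T.tens (b \<otimes>\<^bsub>UEA g\<^esub> cls (?s w + ?r) \<otimes>\<^bsub>UEA g\<^esub> v_class) c =
        T.tens (b \<otimes>\<^bsub>UEA g\<^esub> v_class) (eval_word_sum \<chi> (?s w) * c)
        \<otimes>\<^bsub>T.tensor\<^esub> T.tens (b \<otimes>\<^bsub>UEA g\<^esub> v_class) (eval_word_sum \<chi> ?r * c)"
      using b c v_class_closed insert tens_single[OF b w] by (simp add: T.tens_add_left)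
    also have "\<dots> = T.tens (b \<otimes>\<^bsub>UEA g\<^esub> v_class) (eval_word_sum \<chi> (?s w) * c + eval_word_sum \<chi> ?r * c)"
      using T.tens_add_right[of "b \<otimes>\<^bsub>UEA g\<^esub> v_class" "eval_word_sum \<chi> (?s w) * c" "eval_word_sum \<chi> ?r * c"]
        b v_class_closed by simp
    finally show ?case
      using insert.hyps keys_add_lists[OF s r] by (simp add: eval_add distrib_right)
  qed
  from this[OF subset_refl] show ?thesis using sum_single_keys[of p] by simp
qed

definition right_v where "right_v = T.tens_map (\<lambda>b. b \<otimes>\<^bsub>UEA g\<^esub> v_class)"

lemma right_v_balanced:
  assumes "m \<in> carrier (UEA g)" "y \<in> carrier (UEA (restr g M))"
  shows "T.tens (m \<otimes>\<^bsub>UEA g\<^esub> uea_incl g y \<otimes>\<^bsub>UEA g\<^esub> v_class) n = T.tens (m \<otimes>\<^bsub>UEA g\<^esub> v_class) (uea_char \<chi> y * n)"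
proof -
  obtain p where "N.poly_in p" "y = uea_class (restr g M) p" using assms(2) by (rule N.uea_carrierE)
  then show ?thesis using tens_right_mult[OF assms(1), of p n] by (simp add: uea_incl_class uea_char_class)
qed

lemma right_v_hom: "right_v \<in> hom T.tensor T.tensor"
  unfolding right_v_def
  by (rule T.tens_map_hom) (simp_all add: v_class_closed U.l_distr right_v_balanced)

lemma right_v_tens: "b \<in> carrier (UEA g) \<Longrightarrow> right_v (T.tens b c) = T.tens (b \<otimes>\<^bsub>UEA g\<^esub> v_class) c"
  unfolding right_v_def
  by (subst T.tens_map_tens) (simp_all add: v_class_closed U.l_distr right_v_balanced)

text \<open>The representative in \<open>U(g, e)\<close> of right multiplication by \<open>v\<close>: elements of \<open>U(g, e)\<close> are
  extensional functions.\<close>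

definition \<Theta> where "\<Theta> = restrict right_v (carrier T.tensor)"

lemma right_v_closed: "q \<in> carrier T.tensor \<Longrightarrow> right_v q \<in> carrier T.tensor"
  by (rule hom_in_carrier[OF right_v_hom])

text \<open>Left and right multiplications commute.\<close>

lemma right_v_act:
  assumes a: "a \<in> carrier (UEA g)" and q: "q \<in> carrier T.tensor"
  shows "right_v (Q_act g \<chi> M a q) = Q_act g \<chi> M a (right_v q)"
proof -
  have "(right_v \<circ> Q_act g \<chi> M a) q = (Q_act g \<chi> M a \<circ> right_v) q"
  proof (rule T.hom_eq_on_tens[OF T.group_tensor _ _ _ q])
    show "right_v \<circ> Q_act g \<chi> M a \<in> hom T.tensor T.tensor"
      by (rule hom_compose[OF Q_act_hom[OF a] right_v_hom])
    show "Q_act g \<chi> M a \<circ> right_v \<in> hom T.tensor T.tensor"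
      by (rule hom_compose[OF right_v_hom Q_act_hom[OF a]])
  qed (use a v_class_closed in \<open>simp add: Q_act_tens right_v_tens U.m_assoc\<close>)
  then show ?thesis by simp
qed

lemma \<Theta>_closed: "\<Theta> \<in> End_Q g \<chi> M"
proof -
  have c: "Q_act g \<chi> M a q \<in> carrier T.tensor" if "a \<in> carrier (UEA g)" "q \<in> carrier T.tensor" for a q
    using hom_in_carrier[OF Q_act_hom[OF that(1)] that(2)] .
  have "\<Theta> \<in> hom T.tensor T.tensor"
    unfolding \<Theta>_def
    using monoid.m_closed[OF group.is_monoid[OF T.group_tensor]] right_v_closed hom_mult[OF right_v_hom]
    by (intro homI) simp_all
  then show ?thesis
    unfolding End_Q_def Q_eq Q_smul_def
    by (simp add: \<Theta>_def c right_v_act uea_class_closed keys_letter keys_const)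
qed

lemma uea_part_right_v:
  assumes "a \<in> uea_part g j" shows "a \<otimes>\<^bsub>UEA g\<^esub> v_class \<in> uea_part g (1 + j)"
proof -
  obtain p where p: "Poly_Mapping.keys p \<subseteq> parity_words g j" "a = uea_class g p"
    using assms by (auto simp: uea_part_def)
  have "w @ [v] \<in> parity_words g (1 + j)" if w: "w \<in> parity_words g j" for w
  proof -
    obtain ps where ps: "list_all2 (\<lambda>x p. x \<in> part g p) w ps" "sum_list ps = j"
      using w by (auto simp: parity_words_def)
    then have "list_all2 (\<lambda>x p. x \<in> part g p) (w @ [v]) (ps @ [1]) \<and> sum_list (ps @ [1]) = 1 + j"
      using v_odd by (auto intro: list_all2_appendI)
    then show ?thesis unfolding parity_words_def by blast
  qed
  moreover have "Poly_Mapping.keys (p * letter v) \<subseteq> {w @ [v] | w. w \<in> Poly_Mapping.keys p}"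
    using keys_mult[of p "letter v"] by (auto simp: letter_def plus_list_eq)
  ultimately have "Poly_Mapping.keys (p * letter v) \<subseteq> parity_words g (1 + j)"
    using p(1) by blast
  moreover have "poly_in p" using p(1) parity_words_lists by blast
  then have "a \<otimes>\<^bsub>UEA g\<^esub> v_class = uea_class g (p * letter v)"
    using uea_class_mult[OF _ v_poly, of p] p(2) by (simp add: v_class_def)
  ultimately show ?thesis unfolding uea_part_def by blast
qed

lemma \<Theta>_odd: "\<Theta> \<in> homog (W_superalgebra g \<chi> M) 1"
proof -
  interpret h: group_hom T.tensor T.tensor right_v
    using T.group_tensor right_v_hom by (simp add: group_hom_def group_hom_axioms_def)
  have "\<Theta> ` Q_part g \<chi> M j \<subseteq> Q_part g \<chi> M (1 + j)" for j
  proof -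
    let ?G = "\<lambda>j. {T.tens a c | a c. a \<in> uea_part g j}"
    have G: "?G j \<subseteq> carrier T.tensor" using T.tens_closed uea_part_closed by auto
    have "right_v ` generate T.tensor (?G j) = generate T.tensor (right_v ` ?G j)"
      by (rule h.generate_img[OF G, symmetric])
    also have "\<dots> \<subseteq> generate T.tensor (?G (1 + j))"
    proof (rule h.G.mono_generate)
      show "right_v ` ?G j \<subseteq> ?G (1 + j)"
        using right_v_tens[OF uea_part_closed] uea_part_right_v by blast
    qed
    finally have "right_v ` generate T.tensor (?G j) \<subseteq> generate T.tensor (?G (1 + j))" .
    moreover have "generate T.tensor (?G j) \<subseteq> carrier T.tensor" by (rule h.G.generate_incl[OF G])
    ultimately show ?thesis unfolding Q_part_eq \<Theta>_def by auto
  qed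
  then show ?thesis using \<Theta>_closed unfolding W_superalgebra_def by simp
qed

text \<open>Since \<open>v\<close> is odd, \<open>v\<^sup>2 = [v, v]/2\<close> in \<open>U(g)\<close>, and \<open>[v, v]\<close> acts on the generator by
  \<open>\<chi>([v, v]) = 1\<close>.\<close>

lemma \<Theta>_square:
  assumes vM: "br g v v \<in> M" and vv: "\<chi> (br g v v) = 1"
  shows "\<Theta> \<otimes>\<^bsub>W_superalgebra g \<chi> M\<^esub> \<Theta> = (1 / 2) \<odot>\<^bsub>W_superalgebra g \<chi> M\<^esub> \<one>\<^bsub>W_superalgebra g \<chi> M\<^esub>"
proof -
  let ?P = "letter v * letter v" and ?L = "letter (br g v v)" and ?h = "const (1 / 2) :: 'a list \<Rightarrow>\<^sub>0 complex"
  have brN: "br g v v \<in> part g 0 \<inter> M" using br_part[OF v_odd v_odd] vM by simp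
  have NL: "N.poly_in ?L" by (rule N_letter[OF brN])
  have P: "poly_in ?P" by (rule keys_mult_lists[OF v_poly v_poly])
  have L: "poly_in ?L" by (rule N_poly_in[OF NL])
  have NhL: "N.poly_in (?h * ?L)" by (intro keys_mult_lists keys_const NL)
  have R: "poly_in (const (- 1) * ?P + ?L)" by (intro keys_add_lists keys_mult_lists keys_const P L)
  have swap: "uea_class g ?P = uea_class g (const (- 1) * ?P + ?L)"
    using uea_class_letter_swap[OF v_odd v_odd] by (simp add: ksign_def mult.assoc)
  have half: "?h + ?h = 1" by (simp add: const_add[symmetric] const_1)
  \<comment> \<open>The relation reads \<open>P = -P + L\<close>; splitting \<open>P\<close> into halves and applying it to one of them
    gives \<open>P = L/2\<close>.\<close>
  have "uea_class g ?P = uea_class g (?h * ?P + ?h * ?P)"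
    by (simp add: distrib_right[symmetric] half)
  also have "\<dots> = uea_class g (?h * ?P) \<oplus>\<^bsub>UEA g\<^esub> uea_class g ?h \<otimes>\<^bsub>UEA g\<^esub> uea_class g ?P"
    by (simp only: uea_class_add[OF keys_mult_lists[OF keys_const P] keys_mult_lists[OF keys_const P]]
        uea_class_mult[OF keys_const P])
  also have "\<dots> = uea_class g (?h * ?P) \<oplus>\<^bsub>UEA g\<^esub> uea_class g (?h * (const (- 1) * ?P + ?L))"
    by (simp only: swap uea_class_mult[OF keys_const R])
  also have "\<dots> = uea_class g (?h * ?P + ?h * (const (- 1) * ?P + ?L))"
    by (rule uea_class_add[symmetric, OF keys_mult_lists[OF keys_const P] keys_mult_lists[OF keys_const R]])
  also have "?h * ?P + ?h * (const (- 1) * ?P + ?L) = (?h + ?h * const (- 1)) * ?P + ?h * ?L"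
    by (simp add: distrib_left distrib_right mult.assoc)
  also have "?h + ?h * const (- 1) = 0"
    by (simp add: const_mult_const const_add[symmetric]) (simp add: const_def)
  finally have v_class_sq: "v_class \<otimes>\<^bsub>UEA g\<^esub> v_class = uea_class g (?h * ?L)"
    using uea_class_mult[OF v_poly v_poly] by (simp add: v_class_def)
  have "right_v (right_v q) = Q_smul g \<chi> M (1 / 2) q" if q: "q \<in> carrier T.tensor" for q
  proof -
    have "(right_v \<circ> right_v) q = Q_smul g \<chi> M (1 / 2) q"
    proof (rule T.hom_eq_on_tens[OF T.group_tensor hom_compose[OF right_v_hom right_v_hom] Q_smul_hom _ q])
      fix b c assume b: "b \<in> carrier (UEA g)"
      have "(right_v \<circ> right_v) (T.tens b c) = T.tens (b \<otimes>\<^bsub>UEA g\<^esub> uea_class g (?h * ?L)) c"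
        using b v_class_closed by (simp add: right_v_tens U.m_assoc v_class_sq)
      also have "\<dots> = Q_smul g \<chi> M (1 / 2) (T.tens b c)"
        using b by (simp add: tens_move[OF b NhL] Q_smul_tens eval_mult eval_const eval_letter vv)
      finally show "(right_v \<circ> right_v) (T.tens b c) = Q_smul g \<chi> M (1 / 2) (T.tens b c)" .
    qed
    then show ?thesis by simp
  qed
  then show ?thesis
    unfolding W_superalgebra_def Q_eq \<Theta>_def by (auto simp: compose_def right_v_closed intro!: restrict_ext)
qed

end


section \<open>The odd element of degree \<open>-1\<close> normalising \<open>m\<close>\<close>

context lie_superalgebra
begin

lemma br_even_skew:
  assumes h: "h \<in> part g 0" and x: "x \<in> lspace g" shows "br g x h = - br g h x"
proof -
  obtain x0 x1 where x01: "x = x0 + x1" "x0 \<in> part g 0" "x1 \<in> part g 1" using x by (rule lspaceE)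
  have "br g x0 h = - br g h x0" "br g x1 h = - br g h x1"
    using br_skew[OF x01(2) h] br_skew[OF x01(3) h] by (simp_all add: ksign_def)
  then show ?thesis
    using x01 h by (simp add: br_add_left br_add_right part_lspace)
qed

lemma br_even_derivation:
  assumes h: "h \<in> part g 0" and x: "x \<in> lspace g" and y: "y \<in> lspace g"
  shows "br g h (br g x y) = br g (br g h x) y + br g x (br g h y)"
proof -
  have hL: "h \<in> lspace g" using h by (rule part_lspace)
  have 1: "br g h (br g a b) = br g (br g h a) b + br g a (br g h b)"
    if "a \<in> part g i" "b \<in> part g j" for a b i j
    using jacobi[OF h that] by (simp add: ksign_def)
  obtain y0 y1 where y01: "y = y0 + y1" "y0 \<in> part g 0" "y1 \<in> part g 1" using y by (rule lspaceE)
  note yl = part_lspace[OF y01(2)] part_lspace[OF y01(3)]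
  have 2: "br g h (br g a y) = br g (br g h a) y + br g a (br g h y)" if a: "a \<in> part g i" for a i
    using 1[OF a y01(2)] 1[OF a y01(3)] yl part_lspace[OF a] hL
    by (simp add: y01(1) br_add_right br_lspace)
  obtain x0 x1 where x01: "x = x0 + x1" "x0 \<in> part g 0" "x1 \<in> part g 1" using x by (rule lspaceE)
  note xl = part_lspace[OF x01(2)] part_lspace[OF x01(3)]
  show ?thesis
    using 2[OF x01(2)] 2[OF x01(3)] xl y hL
    by (simp add: x01(1) br_add_left br_add_right br_lspace)
qed

lemma br_eigenspace:
  assumes h: "h \<in> part g 0" and x: "x \<in> eigenspace g h j" and y: "y \<in> eigenspace g h k"
  shows "br g x y \<in> eigenspace g h (j + k)"
proof -
  have l: "x \<in> lspace g" "y \<in> lspace g" using x y by (auto simp: eigenspace_def)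
  have "br g h (br g x y) = br g (smul g (of_int j) x) y + br g x (smul g (of_int k) y)"
    using br_even_derivation[OF h l] x y by (simp add: eigenspace_def)
  also have "\<dots> = smul g (of_int (j + k)) (br g x y)"
    using l by (simp add: br_smul_left br_smul_right L.scale_left_distrib)
  finally show ?thesis using br_lspace[OF l] by (simp add: eigenspace_def)
qed

text \<open>Invariance gives \<open>j (x, y) = ([h, x], y) = -(x, [h, y]) = -k (x, y)\<close>.\<close>

lemma form_eigenspace:
  assumes B: "invariant_form g B" and h: "h \<in> part g 0"
    and x: "x \<in> eigenspace g h j" and y: "y \<in> eigenspace g h k" and jk: "j + k \<noteq> 0"
  shows "B x y = 0"
proof -
  have l: "x \<in> lspace g" "y \<in> lspace g" "h \<in> lspace g"
    using x y part_lspace[OF h] by (auto simp: eigenspace_def)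
  have "of_int j * B x y = B (br g h x) y"
    using x form_smul_left[OF B l(1,2)] by (simp add: eigenspace_def)
  also have "br g h x = smul g (- 1) (br g x h)"
    using br_even_skew[OF h l(1)] by simp
  also have "B \<dots> y = - B x (br g h y)"
    using form_smul_left[OF B br_lspace[OF l(1,3)] l(2), of "- 1"] form_invariant[OF B l(1,3,2)] by simp
  also have "B x (br g h y) = of_int k * B x y"
    using y form_smul[OF B l(1,2)] by (simp add: eigenspace_def)
  finally have "of_int (j + k) * B x y = 0" by (simp add: distrib_right)
  then show ?thesis using jk by (metis mult_eq_0_iff of_int_eq_0_iff)
qed

text \<open>Bilinearity of the bracket, in a form that reduces statements about brackets of spans to the
  spanning sets.  The bracket is linear only on \<open>lspace g\<close>.\<close>

lemma br_span_mem:
  assumes S: "S \<subseteq> lspace g" and S': "S' \<subseteq> lspace g" and W: "L.subspace W"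
    and br: "\<And>x y. \<lbrakk>x \<in> S; y \<in> S'\<rbrakk> \<Longrightarrow> br g x y \<in> W"
    and x: "x \<in> L.span S" and y: "y \<in> L.span S'"
  shows "br g x y \<in> W"
proof -
  have SL: "L.span S \<subseteq> lspace g" and SL': "L.span S' \<subseteq> lspace g"
    using S S' subspace_lspace by (auto intro: L.span_minimal[THEN subsetD])
  have 1: "br g a y \<in> W" if a: "a \<in> S" for a
  proof -
    have aL: "a \<in> lspace g" using a S by blast
    have "y \<in> lspace g \<and> br g a y \<in> W"
      using y
    proof (induction rule: L.span_induct_alt)
      case base
      show ?case using aL by (simp add: br_0_right L.subspace_0[OF W] L.subspace_0[OF subspace_lspace])
    next
      case (step c b z)
      have "b \<in> lspace g" using step S' by blast
      then show ?case
        using step aL br[OF a \<open>b \<in> S'\<close>]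
        by (simp add: br_add_right br_smul_right L.subspace_add[OF W] L.subspace_scale[OF W]
            L.subspace_add[OF subspace_lspace] L.subspace_scale[OF subspace_lspace])
    qed
    then show ?thesis by blast
  qed
  have yL: "y \<in> lspace g" using y SL' by blast
  have "x \<in> lspace g \<and> br g x y \<in> W"
    using x
  proof (induction rule: L.span_induct_alt)
    case base
    show ?case using yL by (simp add: br_0_left L.subspace_0[OF W] L.subspace_0[OF subspace_lspace])
  next
    case (step c b z)
    have "b \<in> lspace g" using step S by blast
    then show ?case
      using step yL 1[OF \<open>b \<in> S\<close>]
      by (simp add: br_add_left br_smul_left L.subspace_add[OF W] L.subspace_scale[OF W]
          L.subspace_add[OF subspace_lspace] L.subspace_scale[OF subspace_lspace])
  qed
  then show ?thesis by blast
qed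

text \<open>Both that \<open>m\<close> carries the character \<open>\<chi>\<close> and that \<open>w\<close> normalises it say that \<open>[x, y] \<in> m\<close> and
  \<open>\<chi>([x, y]) = 0\<close> for \<open>x\<close> among the generators \<open>S\<close> of \<open>m\<close> and \<open>y \<in> S \<union> {w}\<close>.  All these vectors have
  degree at most \<open>-1\<close>, so the bracket has degree at most \<open>-2\<close>, and \<open>\<chi>\<close> kills it unless both have
  degree exactly \<open>-1\<close>.  In that case it vanishes by parity or by the Gram matrices: two indices
  above \<open>s\<close> do not add up to \<open>2s + 1\<close>, nor does an index above \<open>(r + 1)/2\<close> and one that is at
  least \<open>(r + 1)/2\<close> add up to \<open>r + 1\<close>.  For \<open>w\<close> with itself they do, whence \<open>\<chi>([w, w]) = 1\<close>.\<close>

lemma m_space_odd_normaliser: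
  assumes e: "e \<in> part g 0" and h: "h \<in> part g 0" and he: "br g h e = smul g 2 e"
    and B: "invariant_form g B" and ad: "adapted_bases g h (B e) s u r v" and r: "odd r"
  defines "M \<equiv> m_space g h s u r v" and "w \<equiv> v ((r + 1) div 2)"
  shows "odd_normaliser g M (B e) w" and "br g w w \<in> M" and "B e (br g w w) = 1"
proof -
  define low where "low = (\<Union>k\<in>{..- 2}. eigenspace g h k)"
  define S where "S = low \<union> u ` {s + 1..2 * s} \<union> v ` {j. j \<le> r \<and> r + 1 < 2 * j}"
  have M: "M = L.span S" by (simp add: M_def m_space_def S_def low_def)
  have eL: "e \<in> lspace g" and hL: "h \<in> lspace g" using e h by (auto intro: part_lspace)
  have eE: "e \<in> eigenspace g h 2" using eL he by (simp add: eigenspace_def)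
  have u: "u i \<in> eigenspace g h (- 1)" "u i \<in> part g 0" if "i \<in> {1..2 * s}" for i
    using ad that L.span_base[of "u i" "u ` {1..2 * s}"]
    unfolding adapted_bases_def indexed_basis_def by auto
  have v: "v i \<in> eigenspace g h (- 1)" "v i \<in> part g 1" if "i \<in> {1..r}" for i
    using ad that L.span_base[of "v i" "v ` {1..r}"]
    unfolding adapted_bases_def indexed_basis_def by auto
  have gram_u: "B e (br g (u i) (u j)) = (if i + j = 2 * s + 1 then (if i \<le> s then - 1 else 1) else 0)"
    if "i \<in> {1..2 * s}" "j \<in> {1..2 * s}" for i j
    using ad that unfolding adapted_bases_def by blast
  have gram_v: "B e (br g (v i) (v j)) = (if i + j = r + 1 then 1 else 0)"
    if "i \<in> {1..r}" "j \<in> {1..r}" for i j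
    using ad that unfolding adapted_bases_def by blast
  have mid: "(r + 1) div 2 \<in> {1..r}" "(r + 1) div 2 + (r + 1) div 2 = r + 1"
    using r by (auto elim: oddE)
  have S_cases: "(\<exists>k\<le>-2. x \<in> eigenspace g h k) \<or> (\<exists>i\<in>{s + 1..2 * s}. x = u i)
      \<or> (\<exists>j\<in>{1..r}. r + 1 \<le> 2 * j \<and> x = v j)" if "x \<in> insert w S" for x
    using that mid unfolding S_def low_def w_def by force
  have S_cases': "(\<exists>k\<le>-2. x \<in> eigenspace g h k) \<or> (\<exists>i\<in>{s + 1..2 * s}. x = u i)
      \<or> (\<exists>j\<in>{1..r}. r + 1 < 2 * j \<and> x = v j)" if "x \<in> S" for x
    using that unfolding S_def low_def by force
  have deg: "\<exists>k\<le>-1. x \<in> eigenspace g h k" if "x \<in> insert w S" for x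
    using S_cases[OF that]
  proof (elim disjE exE bexE conjE)
    show ?thesis if "k \<le> -2" "x \<in> eigenspace g h k" for k
      using that by (intro exI[of _ k]) simp
    show ?thesis if "i \<in> {s + 1..2 * s}" "x = u i" for i
      using that u(1)[of i] by (intro exI[of _ "- 1"]) simp
    show ?thesis if "j \<in> {1..r}" "x = v j" for j
      using that v(1)[of j] by (intro exI[of _ "- 1"]) simp
  qed
  have SL: "insert w S \<subseteq> lspace g" using deg by (auto simp: eigenspace_def)
  define W where "W = {z \<in> M. z \<in> lspace g \<and> B e z = 0}"
  have W: "L.subspace W"
    unfolding W_def M L.subspace_def using eL
    by (auto simp: form_add[OF B] form_smul[OF B] form_0[OF B] L.span_add L.span_scale L.span_zero
        L.subspace_add[OF subspace_lspace] L.subspace_scale[OF subspace_lspace]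
        L.subspace_0[OF subspace_lspace])
  have lowM: "x \<in> M" if "x \<in> eigenspace g h k" "k \<le> - 2" for x k
    unfolding M using that by (intro L.span_base) (auto simp: S_def low_def)
  have br_low: "br g x y \<in> M" if xy: "x \<in> insert w S" "y \<in> insert w S" for x y
  proof -
    obtain j k where "j \<le> -1" "x \<in> eigenspace g h j" "k \<le> -1" "y \<in> eigenspace g h k"
      using deg[OF xy(1)] deg[OF xy(2)] by blast
    then show ?thesis using lowM[OF br_eigenspace[OF h, of x j y k]] by simp
  qed
  have \<chi>_low: "B e z = 0" if "z \<in> eigenspace g h k" "k < - 2" for z k
    using form_eigenspace[OF B h eE that(1)] that(2) by simp
  have \<chi>_odd: "B e x = 0" if "x \<in> part g 1" for x
    using form_even[OF B e that] by simp
  have \<chi>_br: "B e (br g x y) = 0" if x: "x \<in> S" and y: "y \<in> insert w S" for x y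
  proof -
    obtain j k where jk: "j \<le> -1" "x \<in> eigenspace g h j" "k \<le> -1" "y \<in> eigenspace g h k"
      using deg[of x] deg[OF y] x by blast
    consider (low) "(\<exists>k\<le>-2. x \<in> eigenspace g h k) \<or> (\<exists>k\<le>-2. y \<in> eigenspace g h k)"
      | (uu) i i' where "i \<in> {s + 1..2 * s}" "x = u i" "i' \<in> {s + 1..2 * s}" "y = u i'"
      | (uv) i i' where "i \<in> {s + 1..2 * s}" "x = u i" "i' \<in> {1..r}" "y = v i'"
      | (vu) i i' where "i \<in> {1..r}" "x = v i" "i' \<in> {s + 1..2 * s}" "y = u i'"
      | (vv) i i' where "i \<in> {1..r}" "x = v i" "r + 1 < 2 * i" "i' \<in> {1..r}" "y = v i'" "r + 1 \<le> 2 * i'"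
      using S_cases'[OF x] S_cases[OF y] by metis
    then show ?thesis
    proof cases
      case low
      then show ?thesis
      proof
        assume "\<exists>k\<le>-2. x \<in> eigenspace g h k"
        then obtain k' where "k' \<le> -2" "x \<in> eigenspace g h k'" by blast
        then show ?thesis using \<chi>_low[OF br_eigenspace[OF h, of x k' y k]] jk by simp
      next
        assume "\<exists>k\<le>-2. y \<in> eigenspace g h k"
        then obtain k' where "k' \<le> -2" "y \<in> eigenspace g h k'" by blast
        then show ?thesis using \<chi>_low[OF br_eigenspace[OF h, of x j y k']] jk by simp
      qed
    next
      case uu
      then show ?thesis using gram_u[of i i'] by simp
    next
      case uv
      then have "br g x y \<in> part g (0 + 1)" using br_part[OF u(2)[of i] v(2)[of i']] by simp
      then show ?thesis using \<chi>_odd by simp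
    next
      case vu
      then have "br g x y \<in> part g (1 + 0)" using br_part[OF v(2)[of i] u(2)[of i']] by simp
      then show ?thesis using \<chi>_odd by simp
    next
      case vv
      have "i + i' \<noteq> r + 1" using vv by linarith
      then show ?thesis using vv gram_v[of i i'] by simp
    qed
  qed
  have gens: "br g x y \<in> W" if "x \<in> S" "y \<in> insert w S" for x y
    using br_low[of x y] \<chi>_br[OF that] that SL by (auto simp: W_def intro!: br_lspace)
  have brW: "br g x y \<in> W" if "x \<in> M" "y \<in> L.span (insert w S)" for x y
    by (rule br_span_mem[OF _ SL W gens]) (use SL that M in auto)
  have MS: "M \<subseteq> L.span (insert w S)" unfolding M by (rule L.span_mono) blast
  have wS: "w \<in> L.span (insert w S)" by (rule L.span_base) simp
  show "odd_normaliser g M (B e) w"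
  proof (intro odd_normaliser.intro subalgebra_character.intro)
    show "lie_superalgebra g" by (rule lie_superalgebra_axioms)
    show "subalgebra_character_axioms g M (B e)"
    proof (rule subalgebra_character_axioms.intro)
      show "L.subspace M" by (simp add: M)
    next
      fix x i y j assume "x \<in> part g i \<inter> M" "y \<in> part g j \<inter> M"
      then have "br g x y \<in> W" using brW MS by blast
      then show "br g x y \<in> M" "B e (br g x y) = 0" by (simp_all add: W_def)
    qed (use eL \<chi>_odd in \<open>simp_all add: form_add[OF B] form_smul[OF B]\<close>)
    show "odd_normaliser_axioms g M (B e) w"
    proof (rule odd_normaliser_axioms.intro)
      show "w \<in> part g 1" using v(2)[OF mid(1)] by (simp add: w_def)
    next
      fix x i assume "x \<in> part g i \<inter> M"
      then have "br g x w \<in> W" using brW wS by blast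
      then show "br g x w \<in> M" "B e (br g x w) = 0" by (simp_all add: W_def)
    qed
  qed
  show "br g w w \<in> M" by (rule br_low) simp_all
  show "B e (br g w w) = 1" unfolding w_def using gram_v[OF mid(1) mid(1)] mid(2) by simp
qed

end

section \<open>One-dimensional representations\<close>

text \<open>One of \<open>V 0\<close>, \<open>V 1\<close> is zero, and an odd element maps each into the other.\<close>

lemma odd_acts_by_zero:
  assumes \<rho>: "super_representation A sc V \<rho>" and dim: "vector_space.dim sc (UNIV :: 'v :: ab_group_add set) = 1"
    and a: "a \<in> homog A 1" and aA: "a \<in> carrier A"
  shows "\<rho> a = (\<lambda>x :: 'v. 0)"
proof -
  interpret S: vector_space sc using \<rho> unfolding super_representation_def by (elim conjE) assumption
  have sub: "S.subspace (V i)" for i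
    using \<rho> unfolding super_representation_def by (elim conjE) (erule spec)
  have int: "V 0 \<inter> V 1 = {0}"
    using \<rho> unfolding super_representation_def by (elim conjE) assumption
  have sum: "{x + y | x y. x \<in> V 0 \<and> y \<in> V 1} = UNIV"
    using \<rho> unfolding super_representation_def by (elim conjE) assumption
  have odd: "\<rho> a ` V j \<subseteq> V (1 + j)" for j
  proof -
    have "\<forall>i j. \<forall>a\<in>homog A i. \<rho> a ` V j \<subseteq> V (i + j)"
      using \<rho> unfolding super_representation_def by (elim conjE) assumption
    then show ?thesis by (elim allE) (erule bspec, rule a)
  qed
  interpret l: Vector_Spaces.linear sc sc "\<rho> a"
  proof -
    have "\<forall>a\<in>carrier A. Vector_Spaces.linear sc sc (\<rho> a)"
      using \<rho> unfolding super_representation_def by (elim conjE) assumption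
    then show "Vector_Spaces.linear sc sc (\<rho> a)" using aA by simp
  qed
  obtain X where X: "X \<subseteq> UNIV" "S.independent X" "UNIV \<subseteq> S.span X" "card X = S.dim (UNIV :: 'v set)"
    using S.basis_exists by blast
  have "finite X" using X(4) dim by (intro card_ge_0_finite) simp
  have "S.dim (V 0) + S.dim (V 1) = 1"
    using S.dim_direct_sum[OF sub[of 0] sub[of 1] \<open>finite X\<close>] X(3) int
    unfolding sum dim by (simp add: top_unique)
  then have "S.dim (V 0) = 0 \<or> S.dim (V 1) = 0" by linarith
  moreover have "V i \<subseteq> {0}" if "S.dim (V i) = 0" for i
  proof -
    obtain Y where Y: "Y \<subseteq> V i" "S.independent Y" "V i \<subseteq> S.span Y" "card Y = S.dim (V i)"
      using S.basis_exists by blast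
    have "finite Y" using S.independent_span_bound[OF \<open>finite X\<close> Y(2)] X(3) by (simp add: top_unique)
    then show ?thesis using Y that by simp
  qed
  ultimately obtain i where i: "V i \<subseteq> {0}" by blast
  have "\<rho> a x = 0" if "x \<in> V j" for x j
  proof (cases "j = i")
    case True
    then show ?thesis using that i l.zero by auto
  next
    case False
    then have "1 + j = i" by (cases i; cases j) auto
    then show ?thesis using odd[of j] that i by blast
  qed
  then have zero: "\<rho> a (x + y) = 0" if "x \<in> V 0" "y \<in> V 1" for x y
    using that l.add[of x y] by simp
  show ?thesis
  proof
    fix z :: 'v
    have "z \<in> {x + y | x y. x \<in> V 0 \<and> y \<in> V 1}" unfolding sum by (rule UNIV_I)
    then show "\<rho> a z = 0" using zero by auto
  qed
qed

lemma no_one_dimensional_representation: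
  assumes \<rho>: "super_representation A sc V \<rho>" and dim: "vector_space.dim sc (UNIV :: 'v :: ab_group_add set) = 1"
    and a: "a \<in> homog A 1" and aA: "a \<in> carrier A" and one: "\<one>\<^bsub>A\<^esub> \<in> carrier A"
    and sq: "a \<otimes>\<^bsub>A\<^esub> a = c \<odot>\<^bsub>A\<^esub> \<one>\<^bsub>A\<^esub>" and c: "c \<noteq> 0"
  shows False
proof -
  interpret S: vector_space sc using \<rho> unfolding super_representation_def by (elim conjE) assumption
  have "\<rho> (a \<otimes>\<^bsub>A\<^esub> a) = \<rho> a \<circ> \<rho> a" using \<rho> aA unfolding super_representation_def by blast
  moreover have "\<rho> (c \<odot>\<^bsub>A\<^esub> \<one>\<^bsub>A\<^esub>) = (\<lambda>x. sc c (\<rho> \<one>\<^bsub>A\<^esub> x))" "\<rho> \<one>\<^bsub>A\<^esub> = id"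
    using \<rho> one unfolding super_representation_def by blast+
  ultimately have "sc c x = 0" for x :: 'v
    using odd_acts_by_zero[OF \<rho> dim a aA] sq by (metis comp_apply id_apply)
  then have "(UNIV :: 'v set) \<subseteq> {0}" using c by (auto simp: S.scale_eq_0_iff)
  then have "S.dim (UNIV :: 'v set) = 0"
    using S.dim_le_card[of UNIV "{}"] by simp
  then show False using dim by simp
qed

theorem proposition2p7:
  fixes g :: "('a :: ab_group_add) lie_super"
    and e h f :: 'a
    and B :: "'a \<Rightarrow> 'a \<Rightarrow> complex"
    and s r :: nat and u v :: "nat \<Rightarrow> 'a"
    and sc :: "complex \<Rightarrow> ('v :: ab_group_add) \<Rightarrow> 'v"
  assumes "basic_lie_superalgebra g"
    and "nilpotent_element g e"
    and "sl2_triple g e h f"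
    and "normalised_form g e f B"
    and "adapted_bases g h (B e) s u r v"
    and "odd (d1 g e)"
  shows "\<not> (\<exists>V \<rho>. super_representation (W_superalgebra g (B e) (m_space g h s u r v)) sc V \<rho>
                \<and> vector_space.dim sc (UNIV :: 'v set) = 1)"
proof
  let ?M = "m_space g h s u r v" and ?w = "v ((r + 1) div 2)"
  let ?W = "W_superalgebra g (B e) ?M"
  assume "\<exists>V \<rho>. super_representation ?W sc V \<rho> \<and> vector_space.dim sc (UNIV :: 'v set) = 1"
  then obtain V \<rho> where \<rho>: "super_representation ?W sc V \<rho>"
    and dim: "vector_space.dim sc (UNIV :: 'v set) = 1" by blast
  have g: "lie_superalgebra g" and fd: "finite_dimensional g"
    using assms(1) unfolding basic_lie_superalgebra_def by auto
  have e: "e \<in> part g 0" and h: "h \<in> part g 0" and he: "br g h e = smul g 2 e"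
    using assms(3) unfolding sl2_triple_def by auto
  have B: "invariant_form g B" using assms(4) unfolding normalised_form_def by simp
  have "even (d1 g e - int r)" by (rule lie_superalgebra.d1_parity[OF g B fd e h he assms(5)])
  then have r: "odd r" using assms(6) by auto
  note w = lie_superalgebra.m_space_odd_normaliser[OF g e h he B assms(5) r]
  interpret odd_normaliser g ?M "B e" ?w by (rule w(1))
  have "\<Theta> \<in> carrier ?W" using \<Theta>_closed by (simp add: W_superalgebra_def)
  then show False
    using no_one_dimensional_representation[OF \<rho> dim \<Theta>_odd _ W_one_closed \<Theta>_square[OF w(2,3)]]
    by simp
qed

end
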